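(* Every local triple derivation (not assumed to be continuous) on a real or complex JB$^*$-triple is continuous. Consequently, every local triple derivation on a (complex) JB$^*$-triple is a triple derivation.
   Context: A (complex) JB$^*$-triple is a complex Banach space $E$ with a continuous triple product $\{\cdot,\cdot,\cdot\}:E\times E\times E\to E$ which is conjugate linear in the middle variable and symmetric and bilinear in the outer variables, such that: (a) $\{a,b,\{x,y,z\}\}=\{\{a,b,x\},y,z\}-\{x,\{b,a,y\},z\}+\{x,y,\{a,b,z\}\}$ for all $a,b,x,y,z\in E$; (b) for each $a\in E$ the operator $L(a,a):x\mapsto\{a,a,x\}$ is a hermitian operator with non-negative spectrum; (c) $\|\{a,a,a\}\|=\|a\|^3$ for all $a\in E$. A real JB$^*$-triple is a norm closed real subtriple of a JB$^*$-triple, i.e. a norm closed real linear subspace closed under the triple product. A triple derivation on a complex (respectively, real) JB$^*$-triple $E$ is a complex linear (respectively, real linear) map $\delta:E\to E$ with $\delta\{a,b,c\}=\{\delta(a),b,c\}+\{a,\delta(b),c\}+\{a,b,\delta(c)\}$ for all $a,b,c\in E$. A local triple derivation on $E$ is a complex linear (respectively, real linear) map $T:E\to E$ such that for each $a\in E$ there exists a triple derivation $\delta_a$ on $E$ with $T(a)=\delta_a(a)$. *)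

theory Defs
  imports "HOL-Analysis.Analysis"
begin

text \<open>A complex Banach space is a real Banach space (type class \<open>banach\<close>) with a complex scalar
  multiplication that extends the real one and for which the norm is absolutely homogeneous.\<close>

locale complex_banach_space = vector_space scaleC
  for scaleC :: "complex \<Rightarrow> 'a::banach \<Rightarrow> 'a" +
  assumes scaleC_of_real: "scaleC (complex_of_real r) x = r *\<^sub>R x"
    and norm_scaleC: "norm (scaleC c x) = cmod c * norm x"

text \<open>The spatial numerical range: all \<open>f (T x)\<close> where \<open>f\<close> is a norm-one functional in the complex
  dual that attains its norm at the unit vector \<open>x\<close>.  For complex-linear functionals the real
  operator norm \<open>onorm\<close> is the complex one.\<close>

definition numerical_range :: "(complex \<Rightarrow> 'a::banach \<Rightarrow> 'a) \<Rightarrow> ('a \<Rightarrow> 'a) \<Rightarrow> complex set" where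
  "numerical_range scaleC T =
    {f (T x) | f x. Vector_Spaces.linear scaleC (*) f \<and> bounded_linear f \<and> onorm f = 1
                    \<and> norm x = 1 \<and> f x = 1}"

definition hermitian_operator :: "(complex \<Rightarrow> 'a::banach \<Rightarrow> 'a) \<Rightarrow> ('a \<Rightarrow> 'a) \<Rightarrow> bool" where
  "hermitian_operator scaleC T \<longleftrightarrow>
    Vector_Spaces.linear scaleC scaleC T \<and> bounded_linear T \<and> numerical_range scaleC T \<subseteq> \<real>"

text \<open>The spectrum in the Banach algebra of bounded complex-linear operators on the whole space.\<close>

definition operator_spectrum :: "(complex \<Rightarrow> 'a::banach \<Rightarrow> 'a) \<Rightarrow> ('a \<Rightarrow> 'a) \<Rightarrow> complex set" where
  "operator_spectrum scaleC T =
    {\<mu>. \<not> (\<exists>S. Vector_Spaces.linear scaleC scaleC S \<and> bounded_linear S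
              \<and> (\<forall>x. S (T x - scaleC \<mu> x) = x) \<and> (\<forall>x. T (S x) - scaleC \<mu> (S x) = x))}"

text \<open>\<open>tp x y z\<close> is the triple product, conjugate linear in \<open>y\<close>; linearity in the third variable
  follows from linearity in the first and symmetry.\<close>

locale JB_star_triple = complex_banach_space scaleC
  for scaleC :: "complex \<Rightarrow> 'a::banach \<Rightarrow> 'a" +
  fixes tp :: "'a \<Rightarrow> 'a \<Rightarrow> 'a \<Rightarrow> 'a"
  assumes tp_continuous: "continuous_on UNIV (\<lambda>(x, y, z). tp x y z)"
    and tp_symmetric: "tp x y z = tp z y x"
    and tp_add_left: "tp (x + x') y z = tp x y z + tp x' y z"
    and tp_scaleC_left: "tp (scaleC c x) y z = scaleC c (tp x y z)"
    and tp_add_middle: "tp x (y + y') z = tp x y z + tp x y' z"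
    and tp_scaleC_middle: "tp x (scaleC c y) z = scaleC (cnj c) (tp x y z)"
    and jordan_identity:
      "tp a b (tp x y z) = tp (tp a b x) y z - tp x (tp b a y) z + tp x y (tp a b z)"
    and hermitian_L: "hermitian_operator scaleC (\<lambda>x. tp a a x)"
    and spectrum_L_nonneg: "operator_spectrum scaleC (\<lambda>x. tp a a x) \<subseteq> \<real>\<^sub>\<ge>\<^sub>0"
    and norm_cube: "norm (tp a a a) = norm a ^ 3"

text \<open>A real JB*-triple is the set \<open>E\<close> with the structure restricted from an ambient (complex)
  JB*-triple; \<open>subspace\<close> refers to real scalars.\<close>

definition real_JB_star_triple ::
    "(complex \<Rightarrow> 'a::banach \<Rightarrow> 'a) \<Rightarrow> ('a \<Rightarrow> 'a \<Rightarrow> 'a \<Rightarrow> 'a) \<Rightarrow> 'a set \<Rightarrow> bool" where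
  "real_JB_star_triple scaleC tp E \<longleftrightarrow>
    JB_star_triple scaleC tp \<and> subspace E \<and> closed E
    \<and> (\<forall>x\<in>E. \<forall>y\<in>E. \<forall>z\<in>E. tp x y z \<in> E)"

text \<open>The notions below are parametrised by the scalar multiplication, so that \<open>scaleC\<close> with carrier
  \<open>UNIV\<close> gives those for complex triples and \<open>scaleR\<close> those for a real triple.
  Maps on \<open>E\<close> are total functions whose values outside \<open>E\<close> are irrelevant.\<close>

definition linear_self_map_on :: "('k \<Rightarrow> 'a::ab_group_add \<Rightarrow> 'a) \<Rightarrow> 'a set \<Rightarrow> ('a \<Rightarrow> 'a) \<Rightarrow> bool" where
  "linear_self_map_on smul E T \<longleftrightarrow>
    (\<forall>x\<in>E. T x \<in> E) \<and> (\<forall>x\<in>E. \<forall>y\<in>E. T (x + y) = T x + T y)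
    \<and> (\<forall>c. \<forall>x\<in>E. T (smul c x) = smul c (T x))"

definition triple_derivation ::
    "('k \<Rightarrow> 'a::ab_group_add \<Rightarrow> 'a) \<Rightarrow> ('a \<Rightarrow> 'a \<Rightarrow> 'a \<Rightarrow> 'a) \<Rightarrow> 'a set \<Rightarrow> ('a \<Rightarrow> 'a) \<Rightarrow> bool" where
  "triple_derivation smul tp E \<delta> \<longleftrightarrow>
    linear_self_map_on smul E \<delta>
    \<and> (\<forall>a\<in>E. \<forall>b\<in>E. \<forall>c\<in>E. \<delta> (tp a b c) = tp (\<delta> a) b c + tp a (\<delta> b) c + tp a b (\<delta> c))"

definition local_triple_derivation ::
    "('k \<Rightarrow> 'a::ab_group_add \<Rightarrow> 'a) \<Rightarrow> ('a \<Rightarrow> 'a \<Rightarrow> 'a \<Rightarrow> 'a) \<Rightarrow> 'a set \<Rightarrow> ('a \<Rightarrow> 'a) \<Rightarrow> bool" where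
  "local_triple_derivation smul tp E T \<longleftrightarrow>
    linear_self_map_on smul E T
    \<and> (\<forall>a\<in>E. \<exists>\<delta>. triple_derivation smul tp E \<delta> \<and> T a = \<delta> a)"

end

theory Submission
  imports Defs "HOL-Complex_Analysis.Complex_Analysis"
begin

text \<open>
  Call a functional supporting at a unit vector \<open>z\<close> if it has norm one and takes the value \<open>1\<close>
  at \<open>z\<close>. Everything rests on the fact that a triple derivation \<open>\<delta>\<close> satisfies
  \<open>Re f (\<delta> x) = 0\<close> whenever \<open>f\<close> supports \<open>x\<close>. A local triple derivation \<open>T\<close> agrees at
  each point with some derivation, so it inherits this property; hence
  \<open>norm x \<le> norm (x - t T x)\<close> for all real \<open>t\<close>, and an everywhere defined operator of this kind has
  closed graph and is therefore bounded.

  To see that \<open>Re f (\<delta> x) = 0\<close>, consider the plateau map \<open>p u = (3 u - {u,u,u}) / 2\<close>. The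
  scalar function \<open>s \<mapsto> (3 s - s^3) / 2\<close> maps \<open>[0,2]\<close> into \<open>[-1,1]\<close>, takes the value \<open>1\<close> at \<open>1\<close>
  and has vanishing derivative there. Correspondingly \<open>p\<close> maps the ball of radius two into the
  unit ball (\<open>norm_plateau_le\<close>), and every \<open>x\<close> in the unit ball is \<open>p y\<close> for some \<open>y\<close> in the unit
  ball of the closed real subtriple generated by \<open>x\<close> (\<open>plateau_surjective\<close>). If \<open>y\<close> moves with
  velocity \<open>\<delta> y\<close>, then \<open>p (y + t \<delta> y) = x + t \<delta> x + O(t^2)\<close> stays in the unit ball for small
  positive and negative \<open>t\<close>, so \<open>\<delta> x\<close> is tangent to the unit ball at \<open>x\<close>.

  The bound on \<open>p\<close> says that \<open>norm (4 {x,x,x} - 3 x) \<le> 1\<close> if \<open>norm x \<le> 1\<close>, an instance of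
  the Gelfand representation of the subtriple generated by \<open>x\<close>. It has a direct proof. Let
  \<open>\<tau> k\<close> be the odd Chebyshev polynomial of degree \<open>2 k + 1\<close> evaluated at \<open>x\<close>. Their generating
  function is a resolvent of \<open>L = L(x,x)\<close> composed with the map \<open>w \<mapsto> 4 w / (1 + w)^2\<close> from the
  unit disc onto the plane slit along \<open>[1,\<infinity>)\<close>. As the spectrum of \<open>L\<close> is nonnegative and the odd
  powers of \<open>x\<close> are bounded, it is holomorphic on the disc, and Cauchy's inequality shows that
  \<open>norm (\<tau> k)\<close> grows subexponentially. On the other hand \<open>4 cos^3 t = cos (3 t) + 3 cos t\<close> and
  \<open>norm {u,u,u} = (norm u)^3\<close> force exponential growth as soon as \<open>norm (\<tau> 1) > 1\<close>.

  For complex triples the same tangent vectors, together with the hermitian operators \<open>L(a,a)\<close>,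
  give \<open>f {v,z,z} = f v\<close> and \<open>f {z,v,z} = cnj (f v)\<close> whenever \<open>f\<close> supports \<open>z\<close> (\<open>supports_tp\<close>).
  Let \<open>T\<close> agree with the derivation \<open>\<delta>\<close> at \<open>z\<close>, and put \<open>G = T - \<delta>\<close>. Then \<open>f\<close> composed with
  \<open>(1 - t G)^{-1}\<close> still supports \<open>z\<close>, and differentiating the second identity along this family
  shows that \<open>f\<close> annihilates \<open>Q z = T {z,a,z} - 2 {T z,a,z} - {z,T a,z}\<close>. So \<open>Q\<close> is a
  homogeneous quadratic map tangent to the unit sphere in every complex direction, and such a map
  vanishes by an argument in the style of Cartan's uniqueness theorem (\<open>quadratic_zero\<close>).
\<close>

section \<open>Supporting functionals\<close>

definition sublinear_functional :: "('a::real_vector \<Rightarrow> real) \<Rightarrow> bool" where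
  "sublinear_functional q \<longleftrightarrow>
    (\<forall>u v. q (u + v) \<le> q u + q v) \<and> (\<forall>r>0. \<forall>u. q (r *\<^sub>R u) = r * q u)"

lemma sublinear_zero:
  assumes "sublinear_functional q" shows "q 0 = 0"
proof -
  have "q ((2::real) *\<^sub>R 0) = 2 * q 0"
    using assms unfolding sublinear_functional_def by (metis zero_less_numeral)
  then show ?thesis by simp
qed

lemma sublinear_minus:
  assumes "sublinear_functional q" shows "- q (- u) \<le> q u"
proof -
  have "q (u + - u) \<le> q u + q (- u)"
    using assms unfolding sublinear_functional_def by blast
  then show ?thesis using sublinear_zero[OF assms] by simp
qed

lemma sublinear_functionalI:
  assumes "\<And>u v. q (u + v) \<le> q u + q v" and le: "\<And>r u. r > 0 \<Longrightarrow> q (r *\<^sub>R u) \<le> r * q u"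
  shows "sublinear_functional q"
proof -
  have "q (r *\<^sub>R u) = r * q u" if "r > 0" for r u
  proof (rule antisym[OF le[OF that]])
    have "q (inverse r *\<^sub>R (r *\<^sub>R u)) \<le> inverse r * q (r *\<^sub>R u)"
      using that by (intro le) auto
    then show "r * q u \<le> q (r *\<^sub>R u)"
      using that by (simp add: field_simps)
  qed
  then show ?thesis using assms unfolding sublinear_functional_def by auto
qed

text \<open>The infimum of \<open>q (u + t v) - t q v\<close> over \<open>t \<ge> 0\<close> is the largest sublinear functional below
  \<open>q\<close> that grows with constant slope \<open>q v\<close> in direction \<open>v\<close>.\<close>

lemma sublinear_tilt:
  assumes q: "sublinear_functional q"
  obtains q' where "sublinear_functional q'" "\<And>u. q' u \<le> q u" "\<And>u. q' u \<le> q (u + v) - q v"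
proof -
  have sub: "q (a + b) \<le> q a + q b" for a b
    using q unfolding sublinear_functional_def by blast
  have hom: "q (r *\<^sub>R a) = r * q a" if "r \<ge> 0" for r a
    using q that sublinear_zero[OF q] unfolding sublinear_functional_def
    by (cases "r = 0") auto
  define q' where "q' u = (INF t\<in>{0..}. q (u + t *\<^sub>R v) - t * q v)" for u
  have lower: "- q (- u) \<le> q (u + t *\<^sub>R v) - t * q v" if "t \<ge> 0" for u t
    using sub[of "u + t *\<^sub>R v" "- u"] hom[OF that, of v] by simp
  have bdd: "bdd_below ((\<lambda>t. q (u + t *\<^sub>R v) - t * q v) ` {0..})" for u
    using lower[of _ u] by (intro bdd_belowI[of _ "- q (- u)"]) auto
  have le: "q' u \<le> q (u + t *\<^sub>R v) - t * q v" if "t \<ge> 0" for u t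
    unfolding q'_def using that by (intro cINF_lower bdd) auto
  have ge: "c \<le> q' u" if "\<And>t. t \<ge> 0 \<Longrightarrow> c \<le> q (u + t *\<^sub>R v) - t * q v" for c u
    unfolding q'_def using that by (intro cINF_greatest) auto
  have "sublinear_functional q'"
  proof (rule sublinear_functionalI)
    fix a b
    have "q' (a + b) - (q (b + s *\<^sub>R v) - s * q v) \<le> q (a + t *\<^sub>R v) - t * q v"
      if "s \<ge> 0" "t \<ge> 0" for s t
    proof -
      have "q' (a + b) \<le> q ((a + b) + (t + s) *\<^sub>R v) - (t + s) * q v"
        using that by (intro le) auto
      also have "(a + b) + (t + s) *\<^sub>R v = (a + t *\<^sub>R v) + (b + s *\<^sub>R v)"
        by (simp add: algebra_simps)
      also have "q \<dots> \<le> q (a + t *\<^sub>R v) + q (b + s *\<^sub>R v)" by (rule sub)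
      finally show ?thesis by (simp add: algebra_simps)
    qed
    then have "q' (a + b) - (q (b + s *\<^sub>R v) - s * q v) \<le> q' a" if "s \<ge> 0" for s
      using that by (intro ge) auto
    then have "q' (a + b) - q' a \<le> q (b + s *\<^sub>R v) - s * q v" if "s \<ge> 0" for s
      using that by (smt (verit))
    then have "q' (a + b) - q' a \<le> q' b" by (intro ge) auto
    then show "q' (a + b) \<le> q' a + q' b" by simp
  next
    fix r :: real and a assume "r > 0"
    have "q' (r *\<^sub>R a) / r \<le> q (a + t *\<^sub>R v) - t * q v" if "t \<ge> 0" for t
    proof -
      have "q' (r *\<^sub>R a) \<le> q (r *\<^sub>R a + (r * t) *\<^sub>R v) - (r * t) * q v"
        using that \<open>r > 0\<close> by (intro le) auto
      also have "r *\<^sub>R a + (r * t) *\<^sub>R v = r *\<^sub>R (a + t *\<^sub>R v)"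
        by (simp add: algebra_simps)
      also have "q \<dots> = r * q (a + t *\<^sub>R v)"
        using \<open>r > 0\<close> by (intro hom) auto
      finally show ?thesis using \<open>r > 0\<close> by (simp add: field_simps)
    qed
    then have "q' (r *\<^sub>R a) / r \<le> q' a" by (intro ge) auto
    then show "q' (r *\<^sub>R a) \<le> r * q' a" using \<open>r > 0\<close> by (simp add: field_simps)
  qed
  moreover have "q' u \<le> q u" for u using le[of 0 u] by simp
  moreover have "q' u \<le> q (u + v) - q v" for u using le[of 1 u] by simp
  ultimately show thesis using that by blast
qed

text \<open>The Hahn-Banach theorem without partially defined functionals: by Zorn's lemma there is a
  minimal sublinear functional below \<open>p\<close>, and minimality against all tilts makes it additive.\<close>

lemma sublinear_dominates_linear:
  assumes p: "sublinear_functional p"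
  obtains f where "linear f" "\<And>u. f u \<le> p u"
proof -
  define A where "A = {q. sublinear_functional q \<and> (\<forall>u. q u \<le> p u)}"
  define P where "P q q' \<longleftrightarrow> (\<forall>u. q' u \<le> q u)" for q q' :: "'a \<Rightarrow> real"
  have "\<exists>m\<in>A. \<forall>a\<in>A. P m a \<longrightarrow> a = m"
  proof (rule predicate_Zorn)
    show "partial_order_on A (relation_of P A)"
      by (rule partial_order_on_relation_ofI)
         (auto simp: P_def fun_eq_iff intro: order.trans antisym)
  next
    fix C assume C: "C \<in> Chains (relation_of P A)"
    have CA: "C \<subseteq> A" using C unfolding Chains_def relation_of_def by auto
    have chain: "P q q' \<or> P q' q" if "q \<in> C" "q' \<in> C" for q q'
      using C that unfolding Chains_def relation_of_def by auto
    show "\<exists>u\<in>A. \<forall>a\<in>C. P a u"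
    proof (cases "C = {}")
      case True
      then show ?thesis using p unfolding A_def by auto
    next
      case False
      define m where "m u = (INF q\<in>C. q u)" for u
      have sl: "sublinear_functional q" and below: "q u \<le> p u" if "q \<in> C" for q u
        using CA that unfolding A_def by auto
      have "- p (- u) \<le> q u" if "q \<in> C" for q u
        using sublinear_minus[OF sl[OF that], of u] below[OF that, of "- u"] by linarith
      then have bdd: "bdd_below ((\<lambda>q. q u) ` C)" for u
        by (intro bdd_belowI[of _ "- p (- u)"]) auto
      have le: "m u \<le> q u" if "q \<in> C" for q u
        unfolding m_def using that by (intro cINF_lower bdd)
      have ge: "c \<le> m u" if "\<And>q. q \<in> C \<Longrightarrow> c \<le> q u" for c u
        unfolding m_def using that False by (intro cINF_greatest)
      have "sublinear_functional m"
      proof (rule sublinear_functionalI)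
        fix a b
        have "m (a + b) - q' b \<le> q a" if q: "q \<in> C" "q' \<in> C" for q q'
        proof -
          have *: "m (a + b) \<le> r a + r b" if "r \<in> C" for r
            using le[OF that, of "a + b"] sl[OF that] unfolding sublinear_functional_def
            by (meson order.trans)
          show ?thesis using chain[OF q] *[OF q(1)] *[OF q(2)] unfolding P_def
            by (smt (verit))
        qed
        then have "m (a + b) - q' b \<le> m a" if "q' \<in> C" for q'
          using that by (intro ge)
        then have "m (a + b) - m a \<le> q' b" if "q' \<in> C" for q'
          using that by (smt (verit))
        then have "m (a + b) - m a \<le> m b" by (intro ge)
        then show "m (a + b) \<le> m a + m b" by simp
      next
        fix r :: real and a assume r: "r > 0"
        have "m (r *\<^sub>R a) / r \<le> q a" if "q \<in> C" for q
          using le[OF that, of "r *\<^sub>R a"] sl[OF that] r unfolding sublinear_functional_def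
          by (simp add: field_simps)
        then have "m (r *\<^sub>R a) / r \<le> m a" by (intro ge)
        then show "m (r *\<^sub>R a) \<le> r * m a" using r by (simp add: field_simps)
      qed
      moreover have "m u \<le> p u" for u
        using False le below by (meson all_not_in_conv order.trans)
      ultimately show ?thesis using le unfolding A_def P_def by auto
    qed
  qed
  then obtain m where "m \<in> A" and min: "\<And>a. a \<in> A \<Longrightarrow> P m a \<Longrightarrow> a = m" by blast
  then have m: "sublinear_functional m" "\<And>u. m u \<le> p u" unfolding A_def by auto
  have add: "m (u + v) = m u + m v" for u v
  proof (rule antisym)
    obtain q where q: "sublinear_functional q" "\<And>u. q u \<le> m u" "\<And>u. q u \<le> m (u + v) - m v"
      by (rule sublinear_tilt[OF m(1), of v]) blast
    have "q \<in> A" using q m(2) unfolding A_def by (auto intro: order.trans)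
    then have "q = m" using q(2) by (intro min) (auto simp: P_def)
    then show "m u + m v \<le> m (u + v)" using q(3)[of u] by simp
  qed (use m(1) in \<open>auto simp: sublinear_functional_def\<close>)
  have neg: "m (- u) = - m u" for u
    using add[of u "- u"] sublinear_zero[OF m(1)] by simp
  have "m (r *\<^sub>R u) = r * m u" for r u
  proof -
    consider "r > 0" | "r = 0" | "- r > 0" by linarith
    then show ?thesis
    proof cases
      case 1 then show ?thesis using m(1) unfolding sublinear_functional_def by auto
    next
      case 2 then show ?thesis using sublinear_zero[OF m(1)] by simp
    next
      case 3
      then have "m ((- r) *\<^sub>R u) = (- r) * m u"
        using m(1) unfolding sublinear_functional_def by blast
      then show ?thesis using neg[of "r *\<^sub>R u"] by simp
    qed
  qed
  then have "linear m" using add by (intro linearI) auto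
  then show thesis using that m(2) by blast
qed

text \<open>Tilting the norm in direction \<open>v\<close> first forces the value at \<open>- v\<close> down to \<open>- norm v\<close>.\<close>

lemma norm_attaining_real_functional:
  fixes v :: "'a::real_normed_vector"
  obtains f where "linear f" "\<And>u. f u \<le> norm u" "f v = norm v"
proof -
  have n: "sublinear_functional (norm :: 'a \<Rightarrow> real)"
    by (rule sublinear_functionalI) (auto simp: norm_triangle_ineq)
  obtain q where q: "sublinear_functional q" "\<And>u::'a. q u \<le> norm u"
    "\<And>u. q u \<le> norm (u + v) - norm v"
    by (rule sublinear_tilt[OF n, of v]) blast
  obtain f where f: "linear f" "\<And>u. f u \<le> q u"
    by (rule sublinear_dominates_linear[OF q(1)]) blast
  have bound: "f u \<le> norm u" for u using f(2) q(2) by (meson order.trans)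
  have "f (- v) \<le> - norm v" using f(2)[of "- v"] q(3)[of "- v"] by simp
  then have "f v = norm v" using bound[of v] linear_neg[OF f(1), of v] by simp
  then show thesis using that f(1) bound by blast
qed

context complex_banach_space
begin

lemma scaleC_scaleR: "scaleC c (r *\<^sub>R u) = r *\<^sub>R scaleC c u"
  by (simp flip: scaleC_of_real add: mult.commute)

lemma scaleR_scaleC: "r *\<^sub>R scaleC c u = scaleC (of_real r * c) u"
  by (simp flip: scaleC_of_real)

lemma scaleC_i_i: "scaleC \<i> (scaleC \<i> u) = - u"
  by (simp add: scale_minus_left)

lemma scaleC_Complex: "scaleC c u = Re c *\<^sub>R u + Im c *\<^sub>R scaleC \<i> u"
proof -
  have "scaleC c u = scaleC (of_real (Re c) + of_real (Im c) * \<i>) u"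
    by (subst complex_eq[of c]) (simp add: mult.commute)
  then show ?thesis
    unfolding scale_left_distrib scaleR_scaleC by (simp add: scaleC_of_real)
qed

lemma bounded_linear_scaleC: "bounded_linear (scaleC c)"
  by (rule bounded_linear_intro[of _ "cmod c"])
     (auto simp: scale_right_distrib scaleC_scaleR norm_scaleC)

text \<open>Norm at most one rather than exactly one, so that every vector, the zero vector included, has a
  contractive functional that attains its norm.\<close>

definition contractive_functional :: "('a \<Rightarrow> complex) \<Rightarrow> bool" where
  "contractive_functional f \<longleftrightarrow> (\<forall>u v. f (u + v) = f u + f v) \<and> (\<forall>c u. f (scaleC c u) = c * f u)
     \<and> (\<forall>u. cmod (f u) \<le> norm u)"

definition supports :: "('a \<Rightarrow> complex) \<Rightarrow> 'a \<Rightarrow> bool" where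
  "supports f z \<longleftrightarrow> contractive_functional f \<and> norm z = 1 \<and> f z = 1"

lemma contractiveD:
  assumes "contractive_functional f"
  shows "f (u + v) = f u + f v" "f (scaleC c u) = c * f u" "cmod (f u) \<le> norm u"
    "f (r *\<^sub>R u) = of_real r * f u" "f 0 = 0" "f (- u) = - f u" "f (u - v) = f u - f v"
    "bounded_linear f"
proof -
  show add: "f (u + v) = f u + f v" and sc: "f (scaleC c u) = c * f u"
    and b: "cmod (f u) \<le> norm u" for u v c
    using assms unfolding contractive_functional_def by auto
  show sr: "f (r *\<^sub>R u) = of_real r * f u" for r u
    using sc[of "of_real r" u] by (simp add: scaleC_of_real)
  show "bounded_linear f"
    by (rule bounded_linear_intro[of _ 1]) (auto simp: add sr b scaleR_conv_of_real)
  then have lin: "linear f" by (rule bounded_linear.linear)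
  show "f 0 = 0" "f (- u) = - f u" "f (u - v) = f u - f v"
    using lin by (auto simp: linear_0 linear_neg linear_diff)
qed

text \<open>The usual complexification \<open>g u - \<i> g (\<i> u)\<close>. It is again contractive because a suitable
  rotation of \<open>u\<close> makes its value real, where it equals \<open>g\<close>.\<close>

lemma norm_attaining_functional:
  obtains f where "contractive_functional f" "f v = of_real (norm v)"
proof -
  obtain g where g: "linear g" "\<And>u. g u \<le> norm u" "g v = norm v"
    by (rule norm_attaining_real_functional) blast
  define f where "f u = Complex (g u) (- g (scaleC \<i> u))" for u
  have ga: "g (u + w) = g u + g w" and gs: "g (r *\<^sub>R u) = r * g u" for u w r
    using g(1) by (auto simp: linear_add linear_scale)
  have add: "f (u + w) = f u + f w" for u w
    by (simp add: f_def ga scale_right_distrib complex_eq_iff)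
  have sr: "f (r *\<^sub>R u) = of_real r * f u" for r u
    by (simp add: f_def gs scaleC_scaleR complex_eq_iff)
  have si: "f (scaleC \<i> u) = \<i> * f u" for u
    using g(1) by (simp add: f_def scaleC_i_i linear_neg complex_eq_iff)
  have sc: "f (scaleC c u) = c * f u" for c u
  proof -
    have "f (scaleC c u) = of_real (Re c) * f u + of_real (Im c) * (\<i> * f u)"
      by (subst scaleC_Complex) (simp add: add sr si)
    also have "\<dots> = c * f u" by (simp add: complex_eq_iff)
    finally show ?thesis .
  qed
  have b: "cmod (f u) \<le> norm u" for u
  proof (cases "f u = 0")
    case False
    \<comment> \<open>The rotation that makes the value of the functional real and nonnegative.\<close>
    define c where "c = cnj (f u) / of_real (cmod (f u))"
    have c: "cmod c = 1" using False by (simp add: c_def norm_divide)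
    have "f (scaleC c u) = of_real (cmod (f u))"
      using False complex_norm_square[of "f u"]
      by (simp add: sc c_def field_simps power2_eq_square)
    then have "cmod (f u) = g (scaleC c u)" by (simp add: f_def complex_eq_iff)
    also have "\<dots> \<le> norm u" using g(2)[of "scaleC c u"] c by (simp add: norm_scaleC)
    finally show ?thesis .
  qed auto
  have "Re (f v) = norm v" using g(3) by (simp add: f_def)
  moreover have "(Re (f v))\<^sup>2 + (Im (f v))\<^sup>2 \<le> (norm v)\<^sup>2"
    using power_mono[OF b[of v], of 2] by (simp add: cmod_power2)
  ultimately have "f v = of_real (norm v)" by (simp add: complex_eq_iff)
  then show thesis using that add sc b unfolding contractive_functional_def by blast
qed

lemma supporting_functional:
  assumes "norm v = 1" obtains f where "supports f v"
  using norm_attaining_functional[of v] assms unfolding supports_def by auto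

end


section \<open>Dissipative operators are bounded\<close>

text \<open>The closed graph theorem, stated for a map that is meaningful only on a closed subspace. By Baire,
  the closure of some sublevel set of \<open>norm (T x)\<close> contains a ball; by symmetry and convexity a
  ball around \<open>0\<close>. So every \<open>u\<close> is approximated up to half its norm by some \<open>a\<close> with
  controlled \<open>T a\<close>, and the successive remainders tend to \<open>0\<close> while their images form a
  convergent sequence, whose limit is \<open>0\<close> because the graph is closed.\<close>

lemma closed_graph_on_subspace:
  fixes T :: "'a::banach \<Rightarrow> 'b::banach"
  assumes E: "subspace E" "closed E"
    and add: "\<And>x y. x \<in> E \<Longrightarrow> y \<in> E \<Longrightarrow> T (x + y) = T x + T y"
    and scale: "\<And>r x. x \<in> E \<Longrightarrow> T (r *\<^sub>R x) = r *\<^sub>R T x"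
    and graph: "\<And>X y. (\<And>n. X n \<in> E) \<Longrightarrow> X \<longlonglongrightarrow> 0 \<Longrightarrow> (\<lambda>n. T (X n)) \<longlonglongrightarrow> y \<Longrightarrow> y = 0"
  obtains K where "K \<ge> 0" "\<And>x. x \<in> E \<Longrightarrow> norm (T x) \<le> K * norm x"
proof -
  have diff: "T (x - y) = T x - T y" if "x \<in> E" "y \<in> E" for x y
    using add[of "x - y" y] that E(1) by (simp add: subspace_diff)
  define A where "A n = {x \<in> E. norm (T x) \<le> real n}" for n
  have A_E: "closure (A n) \<subseteq> E" for n
    by (rule closure_minimal) (auto simp: A_def E)
  have Union: "\<Union>(range (\<lambda>n. closure (A n))) = E"
  proof
    show "E \<subseteq> \<Union>(range (\<lambda>n. closure (A n)))"
    proof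
      fix x assume "x \<in> E"
      moreover obtain n where "norm (T x) \<le> real n" using real_arch_simple[of "norm (T x)"] ..
      ultimately have "x \<in> A n" by (simp add: A_def)
      then have "x \<in> closure (A n)" by (rule subsetD[OF closure_subset])
      then show "x \<in> \<Union>(range (\<lambda>n. closure (A n)))" by auto
    qed
  qed (use A_E in blast)
  have "\<exists>n. (top_of_set E) interior_of (closure (A n)) \<noteq> {}"
  proof (rule ccontr)
    assume "\<not> ?thesis"
    then have "(top_of_set E) interior_of \<Union>(range (\<lambda>n. closure (A n))) = {}"
      using closed_subset[OF A_E closed_closure] E(2)
      by (intro Baire_category_alt disjI1 completely_metrizable_space_closedin
            completely_metrizable_space_euclidean) auto
    then have "(top_of_set E) interior_of E = {}" unfolding Union .
    moreover have "(top_of_set E) interior_of E = E"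
      using interior_of_topspace[of "top_of_set E"] by simp
    ultimately show False using subspace_0[OF E(1)] by auto
  qed
  then obtain n x0 where "x0 \<in> (top_of_set E) interior_of (closure (A n))" by blast
  then obtain U where "openin (top_of_set E) U" "x0 \<in> U" "U \<subseteq> closure (A n)"
    unfolding interior_of_def by blast
  then obtain r where r: "r > 0" and ball: "ball x0 r \<inter> E \<subseteq> closure (A n)" and x0: "x0 \<in> E"
    unfolding openin_contains_ball by blast
  have approx: "\<exists>a\<in>E. norm (T a) \<le> real n \<and> norm (u - a) < e"
    if u: "u \<in> E" "norm u < r" and e: "e > 0" for u e
  proof -
    have "x0 + u \<in> closure (A n)" "x0 - u \<in> closure (A n)"
      using ball x0 u E(1) by (auto intro!: subsetD[OF ball] simp: dist_norm subspace_add subspace_diff)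
    then obtain a b where a: "a \<in> A n" "dist a (x0 + u) < e" and b: "b \<in> A n" "dist b (x0 - u) < e"
      using e unfolding closure_approachable by blast
    define c where "c = (1/2) *\<^sub>R (a - b)"
    have abE: "a \<in> E" "b \<in> E" using a b unfolding A_def by auto
    have "T c = (1/2) *\<^sub>R (T a - T b)"
      unfolding c_def using abE E(1) by (simp add: scale diff subspace_diff)
    then have "norm (T c) \<le> real n"
      using norm_triangle_ineq4[of "T a" "T b"] a b unfolding A_def by simp
    moreover have "u - c = (1/2) *\<^sub>R (((x0 + u) - a) - ((x0 - u) - b))"
      unfolding c_def by (simp add: algebra_simps flip: scaleR_add_left)
    then have "norm (u - c) \<le> (1/2) * (norm ((x0 + u) - a) + norm ((x0 - u) - b))"
      using norm_triangle_ineq4[of "(x0 + u) - a" "(x0 - u) - b"] by simp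
    then have "norm (u - c) < e" using a(2) b(2) by (simp add: dist_norm norm_minus_commute)
    ultimately show ?thesis using abE E(1) unfolding c_def
      by (intro bexI[of _ c]) (auto simp: c_def subspace_diff subspace_scale)
  qed
  define C where "C = 2 * real n / r"
  have C: "C \<ge> 0" using r unfolding C_def by simp
  have "\<exists>a\<in>E. norm (T a) \<le> C * norm u \<and> norm (u - a) \<le> norm u / 2" if u: "u \<in> E" for u
  proof (cases "u = 0")
    case True
    then show ?thesis using scale[of 0 0] E(1) by (intro bexI[of _ 0]) (auto simp: subspace_0)
  next
    case False
    define s where "s = r / (2 * norm u)"
    have s: "s > 0" using r False unfolding s_def by simp
    have "norm (s *\<^sub>R u) < r" using r False unfolding s_def by simp
    then obtain a where a: "a \<in> E" "norm (T a) \<le> real n" "norm (s *\<^sub>R u - a) < s * norm u / 2"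
      using approx[of "s *\<^sub>R u" "s * norm u / 2"] u E(1) s False by (auto simp: subspace_scale)
    define b where "b = (1 / s) *\<^sub>R a"
    have "norm (T b) \<le> (1 / s) * real n"
      unfolding b_def using a s by (simp add: scale divide_right_mono)
    then have "norm (T b) \<le> C * norm u" using r unfolding s_def C_def by (simp add: field_simps)
    moreover have "norm (u - b) \<le> norm u / 2"
    proof -
      have "u - b = (1 / s) *\<^sub>R (s *\<^sub>R u - a)" unfolding b_def using s by (simp add: scaleR_diff_right)
      then have "norm (u - b) = (1 / s) * norm (s *\<^sub>R u - a)" using s by simp
      also have "\<dots> \<le> (1 / s) * (s * norm u / 2)" using s a(3) by (intro mult_left_mono) auto
      finally show ?thesis using s by simp
    qed
    ultimately show ?thesis using a(1) E(1) unfolding b_def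
      by (intro bexI[of _ b]) (auto simp: b_def subspace_scale)
  qed
  then obtain a where a: "\<And>u. u \<in> E \<Longrightarrow> a u \<in> E" "\<And>u. u \<in> E \<Longrightarrow> norm (T (a u)) \<le> C * norm u"
    "\<And>u. u \<in> E \<Longrightarrow> norm (u - a u) \<le> norm u / 2"
    by metis
  have "norm (T u) \<le> (2 * C) * norm u" if u: "u \<in> E" for u
  proof -
    define R where "R k = ((\<lambda>v. v - a v) ^^ k) u" for k
    have R0: "R 0 = u" and RS: "R (Suc k) = R k - a (R k)" for k by (auto simp: R_def)
    have RE: "R k \<in> E" for k
      by (induction k) (auto simp: R0 RS u a(1) subspace_diff[OF E(1)])
    have Rn: "norm (R k) \<le> norm u * (1/2) ^ k" for k
    proof (induction k)
      case (Suc k) then show ?case using a(3)[OF RE[of k]] by (simp add: RS)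
    qed (simp add: R0)
    have step: "norm (T (R k) - T (R (Suc k))) \<le> C * norm u * (1/2) ^ k" for k
    proof -
      have "T (R k) - T (R (Suc k)) = T (a (R k))"
        by (simp add: RS diff RE a(1))
      then have "norm (T (R k) - T (R (Suc k))) \<le> C * norm (R k)" using a(2)[OF RE] by simp
      also have "\<dots> \<le> C * (norm u * (1/2) ^ k)" by (intro mult_left_mono Rn C)
      finally show ?thesis by simp
    qed
    have sums: "(\<lambda>k. C * norm u * (1/2) ^ k) sums (C * norm u * 2)"
      using sums_mult[OF geometric_sums[of "1/2::real"], of "C * norm u"] by simp
    have "summable (\<lambda>k. T (R k) - T (R (Suc k)))"
      by (rule summable_comparison_test'[OF sums_summable[OF sums]]) (rule step)
    then have "(\<lambda>n. \<Sum>k<n. T (R k) - T (R (Suc k))) \<longlonglongrightarrow> (\<Sum>k. T (R k) - T (R (Suc k)))"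
      by (rule summable_LIMSEQ)
    then have "(\<lambda>n. T (R 0) - T (R n)) \<longlonglongrightarrow> (\<Sum>k. T (R k) - T (R (Suc k)))"
      by (simp only: sum_lessThan_telescope'[of "\<lambda>k. T (R k)"])
    then have "(\<lambda>n. T (R 0) - (T (R 0) - T (R n)))
        \<longlonglongrightarrow> T (R 0) - (\<Sum>k. T (R k) - T (R (Suc k)))"
      by (intro tendsto_diff tendsto_const)
    then have "(\<lambda>n. T (R n)) \<longlonglongrightarrow> T u - (\<Sum>k. T (R k) - T (R (Suc k)))" by (simp add: R0)
    moreover have "R \<longlonglongrightarrow> 0"
    proof (rule Lim_null_comparison)
      show "\<forall>\<^sub>F k in sequentially. norm (R k) \<le> norm u * (1/2) ^ k" using Rn by simp
      show "(\<lambda>k. norm u * (1/2) ^ k) \<longlonglongrightarrow> 0"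
        by (intro tendsto_mult_right_zero LIMSEQ_realpow_zero) auto
    qed
    ultimately have "T u - (\<Sum>k. T (R k) - T (R (Suc k))) = 0" using RE graph[of R] by blast
    then have "norm (T u) = norm (\<Sum>k. T (R k) - T (R (Suc k)))" by simp
    also have "\<dots> \<le> (\<Sum>k. C * norm u * (1/2) ^ k)"
      by (rule norm_suminf_le[OF step sums_summable[OF sums]])
    also have "\<dots> = C * norm u * 2" using sums by (simp add: sums_iff)
    finally show ?thesis by simp
  qed
  then show thesis using that[of "2 * C"] C by auto
qed

text \<open>A dissipative operator that is defined everywhere has closed graph: if \<open>X n\<close> tends to \<open>0\<close> and
  \<open>T (X n)\<close> to \<open>y\<close>, dissipativity at \<open>X n / t + y\<close> gives \<open>norm y \<le> t * norm (T y)\<close> in the limit,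
  for every \<open>t > 0\<close>.\<close>

lemma dissipative_bounded:
  fixes T :: "'a::banach \<Rightarrow> 'a"
  assumes E: "subspace E" "closed E" and TE: "\<And>x. x \<in> E \<Longrightarrow> T x \<in> E"
    and add: "\<And>x y. x \<in> E \<Longrightarrow> y \<in> E \<Longrightarrow> T (x + y) = T x + T y"
    and scale: "\<And>r x. x \<in> E \<Longrightarrow> T (r *\<^sub>R x) = r *\<^sub>R T x"
    and dissipative: "\<And>x t. x \<in> E \<Longrightarrow> t > 0 \<Longrightarrow> norm x \<le> norm (x - t *\<^sub>R T x)"
  obtains K where "K \<ge> 0" "\<And>x. x \<in> E \<Longrightarrow> norm (T x) \<le> K * norm x"
proof (rule closed_graph_on_subspace[OF E, of T])
  fix X y assume X: "\<And>n. X n \<in> E" "X \<longlonglongrightarrow> 0" "(\<lambda>n. T (X n)) \<longlonglongrightarrow> y"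
  have y: "y \<in> E"
    using closed_sequentially[OF E(2) _ X(3)] TE X(1) by blast
  have *: "norm y \<le> norm (- (t *\<^sub>R T y))" if t: "t > 0" for t
  proof -
    have XE: "(1 / t) *\<^sub>R X n + y \<in> E" for n
      using X(1) y E(1) by (simp add: subspace_add subspace_scale)
    have "norm ((1 / t) *\<^sub>R X n + y) \<le> norm ((1 / t) *\<^sub>R X n + y - (T (X n) + t *\<^sub>R T y))" for n
      using dissipative[OF XE t, of n] t X(1) y E(1)
      by (simp add: add scale subspace_scale scaleR_add_right)
    moreover have "(\<lambda>n. norm ((1 / t) *\<^sub>R X n + y)) \<longlonglongrightarrow> norm ((1 / t) *\<^sub>R 0 + y)"
      by (intro tendsto_intros X)
    moreover have "(\<lambda>n. norm ((1 / t) *\<^sub>R X n + y - (T (X n) + t *\<^sub>R T y)))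
        \<longlonglongrightarrow> norm ((1 / t) *\<^sub>R 0 + y - (y + t *\<^sub>R T y))"
      by (intro tendsto_intros X)
    ultimately have "norm ((1 / t) *\<^sub>R 0 + y) \<le> norm ((1 / t) *\<^sub>R 0 + y - (y + t *\<^sub>R T y))"
      by (intro LIMSEQ_le) auto
    then show ?thesis by simp
  qed
  have "norm y \<le> 0"
  proof (rule tendsto_lowerbound)
    show "((\<lambda>t. norm (- (t *\<^sub>R T y))) \<longlongrightarrow> 0) (at_right 0)"
      by (rule tendsto_eq_intros refl | simp)+
    show "\<forall>\<^sub>F t in at_right 0. norm y \<le> norm (- (t *\<^sub>R T y))"
      using * by (auto simp: eventually_at_right_field intro: exI[of _ 1])
  qed simp
  then show "y = 0" by simp
qed (use that add scale in auto)

section \<open>The triple product\<close>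

context JB_star_triple
begin

lemma tp_add_right: "tp x y (z + z') = tp x y z + tp x y z'"
  using tp_add_left[of z z' y x] by (simp add: tp_symmetric[of x])

lemma tp_scaleC_right: "tp x y (scaleC c z) = scaleC c (tp x y z)"
  using tp_scaleC_left[of c z y x] by (simp add: tp_symmetric[of x])

lemma tp_scaleR_left: "tp (r *\<^sub>R x) y z = r *\<^sub>R tp x y z"
  using tp_scaleC_left[of "of_real r"] by (simp add: scaleC_of_real)

lemma tp_scaleR_middle: "tp x (r *\<^sub>R y) z = r *\<^sub>R tp x y z"
  using tp_scaleC_middle[of _ "of_real r"] by (simp add: scaleC_of_real)

lemma tp_scaleR_right: "tp x y (r *\<^sub>R z) = r *\<^sub>R tp x y z"
  using tp_scaleC_right[of _ _ "of_real r"] by (simp add: scaleC_of_real)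

lemmas tp_add = tp_add_left tp_add_middle tp_add_right
lemmas tp_scaleR = tp_scaleR_left tp_scaleR_middle tp_scaleR_right

lemma tp_zero: "tp 0 y z = 0" "tp x 0 z = 0" "tp x y 0 = 0"
  using tp_scaleR_left[of 0 0] tp_scaleR_middle[of _ 0 0] tp_scaleR_right[of _ _ 0 0] by auto

lemma tp_minus: "tp (- x) y z = - tp x y z" "tp x (- y) z = - tp x y z" "tp x y (- z) = - tp x y z"
  using tp_scaleR_left[of "-1" x] tp_scaleR_middle[of _ "-1" y] tp_scaleR_right[of _ _ "-1" z] by auto

lemma tp_diff: "tp (x - x') y z = tp x y z - tp x' y z" "tp x (y - y') z = tp x y z - tp x y' z"
  "tp x y (z - z') = tp x y z - tp x y z'"
  by (simp_all only: diff_conv_add_uminus tp_add tp_minus)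

lemma tp_bounded:
  obtains M where "M > 0" "\<And>x y z. norm (tp x y z) \<le> M * norm x * norm y * norm z"
proof -
  have "isCont (\<lambda>(x, y, z). tp x y z) (0, 0, 0)"
    using tp_continuous by (simp add: continuous_on_eq_continuous_at)
  then obtain d where d: "d > 0" and
    dd: "\<And>p. dist p (0, 0, 0) < d \<Longrightarrow> dist (case p of (x, y, z) \<Rightarrow> tp x y z) (tp 0 0 0) < 1"
    unfolding continuous_at_eps_delta by (metis (no_types, lifting) case_prod_conv zero_less_one)
  define s where "s = d / 4"
  have s: "s > 0" using d unfolding s_def by simp
  have small: "norm (tp x y z) \<le> 1" if "norm x \<le> s" "norm y \<le> s" "norm z \<le> s" for x y z
  proof -
    have "dist (x, y, z) (0, 0, 0) \<le> norm x + (norm y + norm z)"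
      using sqrt_sum_squares_le_sum[of "norm x" "norm (y, z)"]
        sqrt_sum_squares_le_sum[of "norm y" "norm z"]
      by (simp add: dist_norm norm_Pair)
    also have "\<dots> < d" using that d unfolding s_def by linarith
    finally have "dist (tp x y z) (tp 0 0 0) < 1" using dd by force
    then show ?thesis by (simp add: tp_zero)
  qed
  have "norm (tp x y z) \<le> (1 / s ^ 3) * norm x * norm y * norm z" for x y z
  proof (cases "x = 0 \<or> y = 0 \<or> z = 0")
    case True then show ?thesis by (auto simp: tp_zero)
  next
    case False
    have "norm (tp ((s / norm x) *\<^sub>R x) ((s / norm y) *\<^sub>R y) ((s / norm z) *\<^sub>R z)) \<le> 1"
      using False s by (intro small) auto
    then have "(s / norm x) * (s / norm y) * (s / norm z) * norm (tp x y z) \<le> 1"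
      using s by (simp add: tp_scaleR mult_ac)
    moreover have "(s / norm x) * (s / norm y) * (s / norm z) * norm (tp x y z)
        = (s ^ 3 * norm (tp x y z)) / (norm x * norm y * norm z)"
      by (simp add: power3_eq_cube)
    moreover have "0 < norm x * norm y * norm z" using False by auto
    ultimately have "s ^ 3 * norm (tp x y z) \<le> norm x * norm y * norm z"
      by (simp only: divide_le_eq_1_pos)
    then show ?thesis using s by (simp add: field_simps)
  qed
  then show thesis using that[of "1 / s ^ 3"] s by simp
qed

lemma tp_tendsto:
  assumes "(f \<longlongrightarrow> a) F" "(g \<longlongrightarrow> b) F" "(h \<longlongrightarrow> c) F"
  shows "((\<lambda>n. tp (f n) (g n) (h n)) \<longlongrightarrow> tp a b c) F"
proof -
  have "isCont (\<lambda>(x, y, z). tp x y z) (a, b, c)"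
    using tp_continuous by (simp add: continuous_on_eq_continuous_at)
  then show ?thesis
    using isCont_tendsto_compose[of "(a, b, c)" "\<lambda>(x, y, z). tp x y z" "\<lambda>n. (f n, g n, h n)" F]
      tendsto_Pair[OF assms(1) tendsto_Pair[OF assms(2,3)]] by simp
qed

definition cube :: "'a \<Rightarrow> 'a" where "cube u = tp u u u"

lemma norm_cube_eq: "norm (cube u) = norm u ^ 3"
  by (simp add: cube_def norm_cube)

text \<open>The odd power of degree \<open>2 k + 1\<close>: the operator \<open>L(x,x)\<close> plays the role of multiplication by
  the square of \<open>x\<close>.\<close>

definition odd_power :: "'a \<Rightarrow> nat \<Rightarrow> 'a" where
  "odd_power x k = ((\<lambda>u. tp x x u) ^^ k) x"

lemma odd_power_0 [simp]: "odd_power x 0 = x"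
  and odd_power_Suc: "odd_power x (Suc k) = tp x x (odd_power x k)"
  by (simp_all add: odd_power_def)

text \<open>Power associativity, by induction on the sum of the three indices. Write \<open>c i j k\<close> for the
  left hand side and \<open>A\<close> for the odd power it should equal. Applying the Jordan identity to
  \<open>L(x,x)\<close> and to the triple \<open>x, x^{2n+1}, x\<close>, and to \<open>L(x, x^{2n+1})\<close> and \<open>{x,x,x}\<close>, gives two
  equations that determine \<open>c 0 (n + 1) 0 = A\<close>. Splitting off two factors \<open>x\<close> from the third
  argument then expresses \<open>c i j (k + 1)\<close> through \<open>A\<close> and the difference of
  \<open>c (n - k + 1) 0 k\<close> and \<open>c 0 (n - k + 1) k\<close>, and this difference vanishes because for \<open>k > 0\<close>
  both of its terms are given by the same formula.\<close>

lemma tp_odd_power: "tp (odd_power x i) (odd_power x j) (odd_power x k) = odd_power x (i + j + k + 1)"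
proof -
  let ?a = "odd_power x"
  define c where "c i j k = tp (?a i) (?a j) (?a k)" for i j k
  have sym: "c i j k = c k j i" for i j k unfolding c_def by (rule tp_symmetric)
  have "\<forall>i j k. i + j + k = n \<longrightarrow> c i j k = ?a (n + 1)" for n
  proof (induction n rule: less_induct)
    case (less N)
    show ?case
    proof (cases N)
      case 0
      then show ?thesis by (auto simp: odd_power_Suc c_def)
    next
      case (Suc n)
      let ?A = "?a (Suc (Suc n))"
      have IH: "c i j k = ?a (i + j + k + 1)" if "i + j + k \<le> n" for i j k
        using less[of "i + j + k"] that Suc by auto
      have top: "c 0 0 (Suc n) = ?A" unfolding c_def by (simp add: odd_power_Suc)
      have mid: "c 0 (Suc n) 0 = ?A"
      proof -
        have e: "tp x (?a n) x = ?a (Suc n)" "tp (?a n) x x = ?a (Suc n)"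
          using IH[of 0 n 0] IH[of n 0 0] unfolding c_def by auto
        have 1: "?A = c 1 n 0 - c 0 (Suc n) 0 + c 0 n 1"
          using jordan_identity[of x x x "?a n" x]
          unfolding c_def e by (simp add: odd_power_Suc)
        have 2: "c 0 n 1 = ?A - c 0 (Suc n) 0 + ?A"
        proof -
          have "c 0 n 1 = tp x (?a n) (tp x x x)" by (simp add: c_def odd_power_Suc)
          also have "\<dots> = tp (?a (Suc n)) x x - tp x (?a (Suc n)) x + tp x x (?a (Suc n))"
            unfolding jordan_identity[of x "?a n" x x x] e ..
          also have "tp (?a (Suc n)) x x = tp x x (?a (Suc n))" by (rule tp_symmetric)
          finally show ?thesis unfolding c_def by (simp only: odd_power_Suc odd_power_0)
        qed
        have "c 1 n 0 = c 0 n 1" by (rule sym)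
        then have "c 0 (Suc n) 0 + ?A - (c 0 n 1 + c 0 n 1) = 0" "c 0 n 1 + c 0 (Suc n) 0 - (?A + ?A) = 0"
          using 1 2 by (simp_all add: algebra_simps)
        moreover have "m + (m + m) = (m + a - (q + q)) + (q + m - (a + a)) + (q + m - (a + a)) + (a + (a + a))"
          for m a q :: 'a by (simp add: algebra_simps)
        ultimately have "c 0 (Suc n) 0 + (c 0 (Suc n) 0 + c 0 (Suc n) 0) = ?A + (?A + ?A)"
          by (metis add_0)
        then have "3 *\<^sub>R c 0 (Suc n) 0 = 3 *\<^sub>R ?A"
          using scaleR_left_distrib[of 1 2 "c 0 (Suc n) 0"] scaleR_left_distrib[of 1 2 ?A]
          by (simp add: scaleR_2)
        then show ?thesis by simp
      qed
      have rec: "c i j (Suc k) = c (Suc (n - k)) 0 k - c 0 (Suc (n - k)) k + ?A"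
        if n: "i + j + k = n" for i j k
      proof -
        have "tp (?a i) (?a j) x = ?a (Suc (n - k))" "tp (?a j) (?a i) x = ?a (Suc (n - k))"
          "tp (?a i) (?a j) (?a k) = ?a (Suc n)"
          using IH[of i j 0] IH[of j i 0] IH[of i j k] n unfolding c_def by (auto simp: add.commute)
        then show ?thesis
          using jordan_identity[of "?a i" "?a j" x x "?a k"] unfolding c_def
          by (simp add: odd_power_Suc)
      qed
      have diag: "c (Suc (n - k)) 0 k = c 0 (Suc (n - k)) k" if "k \<le> n" for k
      proof (cases k)
        case 0
        then show ?thesis using mid top sym[of "Suc n" 0 0] by simp
      next
        case (Suc k')
        then show ?thesis using rec[of "Suc (n - k)" 0 k'] rec[of 0 "Suc (n - k)" k'] that by simp
      qed
      have pos: "c i j (Suc k) = ?A" if "i + j + k = n" for i j k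
        using rec[OF that] diag[of k] that by simp
      have "c i j k = ?A" if "i + j + k = Suc n" for i j k
      proof (cases k)
        case (Suc k')
        then show ?thesis using pos[of i j k'] that by simp
      next
        case 0
        show ?thesis
        proof (cases i)
          case (Suc i')
          then show ?thesis using pos[of k j i'] that sym[of i j k] \<open>k = 0\<close> by simp
        next
          case i: 0
          then show ?thesis using mid that \<open>k = 0\<close> by simp
        qed
      qed
      then show ?thesis unfolding Suc by simp
    qed
  qed
  then show ?thesis unfolding c_def by blast
qed

end


section \<open>Odd functional calculus\<close>

lemma tripled_powers_bounded_imp_le_1:
  fixes s C :: real
  assumes "\<And>n. s ^ (3 ^ n) \<le> C"
  shows "s \<le> 1"
proof (rule ccontr)
  assume "\<not> s \<le> 1"
  then obtain n where n: "C < s ^ n" using real_arch_pow[of s C] by auto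
  have "n \<le> 3 ^ n" using power_gt_expt[of 3 n] by simp
  then have "s ^ n \<le> s ^ (3 ^ n)" using \<open>\<not> s \<le> 1\<close> by (intro power_increasing) auto
  then show False using n assms[of n] by simp
qed

text \<open>The Chebyshev polynomial of degree \<open>2 k + 1\<close> is odd; this is the polynomial in the square of
  the variable that remains after dividing by the variable.\<close>

fun odd_chebyshev :: "nat \<Rightarrow> real poly" where
  "odd_chebyshev 0 = 1"
| "odd_chebyshev (Suc 0) = [:-3, 4:]"
| "odd_chebyshev (Suc (Suc k)) = [:-2, 4:] * odd_chebyshev (Suc k) - odd_chebyshev k"

lemma odd_chebyshev_cos: "cos t * poly (odd_chebyshev k) ((cos t)\<^sup>2) = cos (real (2 * k + 1) * t)"
proof (induction k rule: odd_chebyshev.induct)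
  case 1
  then show ?case by simp
next
  case 2
  show ?case using cos_treble_cos[of t] by (simp add: algebra_simps power2_eq_square power3_eq_cube)
next
  case (3 k)
  let ?a = "real (2 * Suc k + 1) * t"
  have "cos t * poly (odd_chebyshev (Suc (Suc k))) ((cos t)\<^sup>2)
      = (4 * (cos t)\<^sup>2 - 2) * (cos t * poly (odd_chebyshev (Suc k)) ((cos t)\<^sup>2))
        - cos t * poly (odd_chebyshev k) ((cos t)\<^sup>2)"
    by (simp add: algebra_simps)
  also have "\<dots> = (4 * (cos t)\<^sup>2 - 2) * cos ?a - cos (real (2 * k + 1) * t)"
    unfolding 3 ..
  also have "4 * (cos t)\<^sup>2 - 2 = 2 * cos (2 * t)" by (simp add: cos_double_cos)
  also have "real (2 * k + 1) * t = ?a - 2 * t" by (simp add: algebra_simps)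
  also have "2 * cos (2 * t) * cos ?a - cos (?a - 2 * t) = cos (?a + 2 * t)"
    by (simp add: cos_add cos_diff)
  also have "?a + 2 * t = real (2 * Suc (Suc k) + 1) * t" by (simp add: algebra_simps)
  finally show ?case .
qed

text \<open>The identity \<open>4 cos^3 t = cos (3 t) + 3 cos t\<close>; both sides agree at the infinitely many points
  \<open>(cos t)^2\<close>.\<close>

lemma odd_chebyshev_cube:
  "smult 4 (pCons 0 (odd_chebyshev k ^ 3)) = odd_chebyshev (3 * k + 1) + smult 3 (odd_chebyshev k)"
proof -
  let ?d = "smult 4 (pCons 0 (odd_chebyshev k ^ 3)) - (odd_chebyshev (3 * k + 1) + smult 3 (odd_chebyshev k))"
  have "poly ?d y = 0" if y: "y \<in> {0<..1}" for y
  proof -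
    define t where "t = arccos (sqrt y)"
    have c: "cos t = sqrt y" using y by (simp add: t_def order_trans[of _ 0])
    have c2: "(cos t)\<^sup>2 = y" using y c by simp
    have "cos t * poly (smult 4 (pCons 0 (odd_chebyshev k ^ 3))) ((cos t)\<^sup>2)
        = 4 * (cos t * poly (odd_chebyshev k) ((cos t)\<^sup>2)) ^ 3"
      by (simp add: power_mult_distrib power2_eq_square power3_eq_cube)
    also have "\<dots> = cos (3 * (real (2 * k + 1) * t)) + 3 * cos (real (2 * k + 1) * t)"
      unfolding odd_chebyshev_cos cos_treble_cos by simp
    also have "3 * (real (2 * k + 1) * t) = real (2 * (3 * k + 1) + 1) * t"
      by (simp add: algebra_simps)
    also have "cos \<dots> + 3 * cos (real (2 * k + 1) * t)
        = cos t * poly (odd_chebyshev (3 * k + 1) + smult 3 (odd_chebyshev k)) ((cos t)\<^sup>2)"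
      unfolding odd_chebyshev_cos[symmetric] by (simp add: algebra_simps)
    finally show ?thesis using c c2 y by simp
  qed
  then have "{0<..1} \<subseteq> {y. poly ?d y = 0}" by blast
  then have "infinite {y. poly ?d y = 0}"
    by (rule infinite_super) (simp add: infinite_Ioc)
  then have "?d = 0" using poly_roots_finite by blast
  then show ?thesis by simp
qed

context JB_star_triple
begin

lemma odd_power_odd_power: "odd_power (odd_power x j) k = odd_power x (j + k * (2 * j + 1))"
proof (induction k)
  case (Suc k)
  have "odd_power (odd_power x j) (Suc k)
      = odd_power x (j + j + (j + k * (2 * j + 1)) + 1)"
    by (simp only: odd_power_Suc Suc tp_odd_power)
  also have "j + j + (j + k * (2 * j + 1)) + 1 = j + Suc k * (2 * j + 1)" by simp
  finally show ?case .
qed simp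

lemma cube_odd_power: "cube (odd_power x k) = odd_power (cube x) k"
proof -
  have "cube x = odd_power x 1" by (simp add: cube_def odd_power_Suc)
  moreover have "cube (odd_power x k) = odd_power x (k + k + k + 1)"
    by (simp only: cube_def tp_odd_power)
  moreover have "k + k + k + 1 = 1 + k * (2 * 1 + 1)" by simp
  ultimately show ?thesis by (simp only: odd_power_odd_power)
qed

lemma norm_cube_iterate: "norm ((cube ^^ n) u) = norm u ^ (3 ^ n)"
  by (induction n) (simp_all add: norm_cube_eq power_mult[symmetric] mult.commute)

text \<open>A constant in the estimate of the triple product is harmless: the \<open>n\<close>-fold iterated cube of the
  odd power is the odd power of the iterated cube \<open>z\<close> of \<open>x\<close>, hence bounded by \<open>M ^ k\<close>
  independently of \<open>n\<close>, while its norm is the \<open>3 ^ n\<close>-th power of the norm in question.\<close>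

lemma norm_odd_power_le:
  assumes "norm x \<le> 1" shows "norm (odd_power x k) \<le> 1"
proof -
  obtain M where M: "M > 0" "\<And>x y z. norm (tp x y z) \<le> M * norm x * norm y * norm z"
    by (rule tp_bounded) blast
  have crude: "norm (odd_power z k) \<le> M ^ k" if z: "norm z \<le> 1" for z
  proof (induction k)
    case 0 then show ?case using z by simp
  next
    case (Suc k)
    have "norm (odd_power z (Suc k)) \<le> M * norm z * norm z * norm (odd_power z k)"
      unfolding odd_power_Suc by (rule M(2))
    also have "\<dots> \<le> M * 1 * 1 * M ^ k"
      using Suc z M(1) by (intro mult_mono) auto
    finally show ?case by simp
  qed
  have "(cube ^^ n) (odd_power x k) = odd_power ((cube ^^ n) x) k" for n
    by (induction n) (simp_all add: cube_odd_power)
  then have "norm (odd_power x k) ^ (3 ^ n) \<le> M ^ k" for n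
    using crude[of "(cube ^^ n) x"] assms by (metis norm_cube_iterate norm_ge_zero power_le_one)
  then show ?thesis by (rule tripled_powers_bounded_imp_le_1)
qed

text \<open>The odd functional calculus \<open>s \<mapsto> s^{2n+1} p (s^2)\<close>. The offset \<open>n\<close> makes the induction on
  \<open>pCons\<close> go through.\<close>

definition odd_eval :: "'a \<Rightarrow> real poly \<Rightarrow> nat \<Rightarrow> 'a" where
  "odd_eval x p n = (\<Sum>i\<le>degree p. coeff p i *\<^sub>R odd_power x (i + n))"

lemma odd_eval_0 [simp]: "odd_eval x 0 n = 0"
  by (simp add: odd_eval_def)

lemma odd_eval_pCons: "odd_eval x (pCons a p) n = a *\<^sub>R odd_power x n + odd_eval x p (Suc n)"
proof (cases "p = 0")
  case False
  then show ?thesis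
    by (simp add: odd_eval_def sum.atMost_Suc_shift del: sum.atMost_Suc)
qed (simp add: odd_eval_def)

lemma odd_eval_1 [simp]: "odd_eval x 1 n = odd_power x n"
  unfolding one_pCons by (simp add: odd_eval_pCons)

lemma odd_eval_add: "odd_eval x (p + q) n = odd_eval x p n + odd_eval x q n"
  by (induction p q arbitrary: n rule: poly_induct2) (simp_all add: odd_eval_pCons algebra_simps)

lemma odd_eval_smult: "odd_eval x (smult c p) n = c *\<^sub>R odd_eval x p n"
  by (induction p arbitrary: n) (simp_all add: odd_eval_pCons algebra_simps)

lemma odd_eval_diff: "odd_eval x (p - q) n = odd_eval x p n - odd_eval x q n"
  using odd_eval_add[of x "p - q" q n] by simp

lemma tp_odd_eval:
  "tp (odd_eval x p i) (odd_eval x q j) (odd_eval x r k) = odd_eval x (p * q * r) (i + j + k + 1)"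
proof -
  have 1: "tp (odd_eval x p i) (odd_power x j) (odd_power x k) = odd_eval x p (i + j + k + 1)" for i j k
    by (induction p arbitrary: i) (simp_all add: odd_eval_pCons tp_zero tp_add tp_scaleR tp_odd_power)
  have 2: "tp (odd_eval x p i) (odd_eval x q j) (odd_power x k) = odd_eval x (q * p) (i + j + k + 1)"
    for i j k
  proof (induction q arbitrary: j)
    case 0 then show ?case by (simp add: tp_zero)
  next
    case (pCons a q)
    show ?case
      by (simp add: odd_eval_pCons odd_eval_add odd_eval_smult tp_add tp_scaleR 1 pCons)
  qed
  have "tp (odd_eval x p i) (odd_eval x q j) (odd_eval x r k) = odd_eval x (r * (q * p)) (i + j + k + 1)"
  proof (induction r arbitrary: k)
    case 0 then show ?case by (simp add: tp_zero)
  next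
    case (pCons a r)
    show ?case
      by (simp add: odd_eval_pCons odd_eval_add odd_eval_smult tp_add tp_scaleR 2 pCons)
  qed
  then show ?thesis by (simp add: mult_ac)
qed

lemma cube_odd_eval: "cube (odd_eval x p 0) = odd_eval x (pCons 0 (p ^ 3)) 0"
  by (simp add: cube_def tp_odd_eval odd_eval_pCons power3_eq_cube)

lemma tp_odd_eval_shift: "tp x x (odd_eval x p n) = odd_eval x p (Suc n)"
  using tp_odd_eval[of x 1 0 1 0 p n] by simp

definition chebyshev_power :: "'a \<Rightarrow> nat \<Rightarrow> 'a" where
  "chebyshev_power x k = odd_eval x (odd_chebyshev k) 0"

lemma chebyshev_power_0: "chebyshev_power x 0 = x"
  and chebyshev_power_1: "chebyshev_power x (Suc 0) = 4 *\<^sub>R cube x - 3 *\<^sub>R x"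
  and chebyshev_power_Suc_Suc: "chebyshev_power x (Suc (Suc k)) =
    4 *\<^sub>R tp x x (chebyshev_power x (Suc k)) - 2 *\<^sub>R chebyshev_power x (Suc k) - chebyshev_power x k"
  by (simp_all add: chebyshev_power_def odd_eval_pCons odd_power_Suc cube_def odd_eval_diff
      odd_eval_add odd_eval_smult tp_odd_eval_shift)

lemma cube_chebyshev_power:
  "4 *\<^sub>R cube (chebyshev_power x k) = chebyshev_power x (3 * k + 1) + 3 *\<^sub>R chebyshev_power x k"
proof -
  have "4 *\<^sub>R cube (chebyshev_power x k) = odd_eval x (smult 4 (pCons 0 (odd_chebyshev k ^ 3))) 0"
    unfolding chebyshev_power_def cube_odd_eval odd_eval_smult ..
  then show ?thesis
    unfolding odd_chebyshev_cube by (simp add: chebyshev_power_def odd_eval_add odd_eval_smult)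
qed

end


section \<open>Growth of the odd Chebyshev polynomials of an element\<close>

lemma locally_bounded_imp_bounded_on_compact:
  fixes N :: "'a::metric_space \<Rightarrow> real"
  assumes "compact K" and loc: "\<And>z. z \<in> K \<Longrightarrow> \<exists>e>0. \<exists>B. \<forall>w\<in>ball z e. N w \<le> B"
  shows "\<exists>B. \<forall>z\<in>K. N z \<le> B"
proof -
  obtain e B where eB: "\<And>z. z \<in> K \<Longrightarrow> e z > 0" "\<And>z w. z \<in> K \<Longrightarrow> w \<in> ball z (e z) \<Longrightarrow> N w \<le> B z"
    using loc by metis
  obtain D where D: "D \<subseteq> K" "finite D" "K \<subseteq> (\<Union>z\<in>D. ball z (e z))"
    by (rule compactE_image[OF assms(1), of K "\<lambda>z. ball z (e z)"]) (use eB(1) in force)+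
  have "N w \<le> Max (B ` D)" if w: "w \<in> K" for w
  proof -
    obtain z where z: "z \<in> D" "w \<in> ball z (e z)" using D(3) w by blast
    then have "N w \<le> B z" using eB(2) D(1) by blast
    also have "\<dots> \<le> Max (B ` D)" using D(2) z(1) by (intro Max_ge) auto
    finally show ?thesis .
  qed
  then show ?thesis by blast
qed

text \<open>The Koebe map sends the unit disc into the plane slit along \<open>[1,\<infinity>)\<close>, which is the union of the
  unit disc and the complement of the nonnegative reals. If \<open>4 w / (1 + w)^2 = t \<ge> 1\<close>, then \<open>w\<close>
  solves a real quadratic equation with product of roots \<open>1\<close> and nonpositive discriminant, so
  \<open>w\<close> has modulus \<open>1\<close>.\<close>

lemma koebe_in_slit_plane:
  assumes w: "cmod w < 1"
  shows "4 * w / (1 + w)\<^sup>2 \<in> ball 0 1 \<union> - \<real>\<^sub>\<ge>\<^sub>0"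
proof (rule ccontr)
  assume "\<not> ?thesis"
  then have n: "cmod (4 * w / (1 + w)\<^sup>2) \<ge> 1" and "4 * w / (1 + w)\<^sup>2 \<in> \<real>\<^sub>\<ge>\<^sub>0" by auto
  then obtain t where t: "4 * w / (1 + w)\<^sup>2 = of_real t" "t \<ge> 0" unfolding nonneg_Reals_def by auto
  have t1: "t \<ge> 1" using n t(2) unfolding t(1) by simp
  have "1 + w \<noteq> 0" using w by (metis add.commute add_eq_0_iff norm_minus_cancel norm_one less_irrefl)
  then have eq: "4 * w = of_real t * (1 + w)\<^sup>2" using t(1) by (simp add: field_simps)
  define a b where "a = Re w" and "b = Im w"
  have re: "4 * a = t * ((1 + a)\<^sup>2 - b\<^sup>2)" and im: "4 * b = t * (2 * (1 + a) * b)"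
    using arg_cong[OF eq, of Re] arg_cong[OF eq, of Im] by (simp_all add: a_def b_def power2_eq_square algebra_simps)
  have "(cmod w)\<^sup>2 < 1" using w by (simp add: power_less_one_iff)
  then have ab: "a\<^sup>2 + b\<^sup>2 < 1" by (simp add: cmod_power2 a_def b_def)
  show False
  proof (cases "b = 0")
    case True
    have "1 * (1 + a)\<^sup>2 \<le> t * (1 + a)\<^sup>2" using t1 by (intro mult_right_mono) auto
    then have "(1 - a)\<^sup>2 \<le> 0" using re True by (simp add: power2_eq_square algebra_simps)
    then show False using ab by simp
  next
    case False
    have "b * (t * (1 + a)) = b * 2" using im by (simp add: algebra_simps)
    then have 1: "t * (1 + a) = 2" using False mult_left_cancel by blast
    have "t * (2 * (1 + a) * a) = 2 * (t * (1 + a)) * a" by (simp only: mult_ac)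
    also have "\<dots> = t * ((1 + a)\<^sup>2 - b\<^sup>2)" unfolding 1 using re by simp
    finally have "(1 + a)\<^sup>2 - b\<^sup>2 = 2 * (1 + a) * a" using t1 by simp
    then have "a\<^sup>2 + b\<^sup>2 = 1" by (simp add: power2_eq_square algebra_simps)
    then show False using ab by simp
  qed
qed

context complex_banach_space
begin

lemma contractive_suminf:
  assumes "contractive_functional f" "summable X"
  shows "f (suminf X) = (\<Sum>n. f (X n))" "summable (\<lambda>n. f (X n))"
  using bounded_linear.suminf[OF contractiveD(8)[OF assms(1)] assms(2)]
    bounded_linear.summable[OF contractiveD(8)[OF assms(1)] assms(2)] by auto

lemma norm_le_if_contractive_le:
  assumes "\<And>f. contractive_functional f \<Longrightarrow> cmod (f v) \<le> B"
  shows "norm v \<le> B"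
proof -
  obtain f where "contractive_functional f" "f v = of_real (norm v)"
    by (rule norm_attaining_functional)
  then show ?thesis using assms[of f] by simp
qed

text \<open>The vector \<open>(1 - \<zeta> L)^{-1} x\<close>. For \<open>\<zeta>\<close> in \<open>[0,1)\<close> the operator itself may fail to be
  invertible, since \<open>L\<close> may have spectrum beyond \<open>1\<close>; but on the bounded orbit of \<open>x\<close> the Neumann
  series converges. Outside of the nonnegative reals the spectrum hypothesis provides the inverse.
  Where both descriptions apply they agree, because there the solution is unique.\<close>

definition resolvent_solution :: "('a \<Rightarrow> 'a) \<Rightarrow> 'a \<Rightarrow> complex \<Rightarrow> 'a" where
  "resolvent_solution L x \<zeta> =
    (if cmod \<zeta> < 1 then \<Sum>k. scaleC (\<zeta> ^ k) ((L ^^ k) x) else SOME u. u - scaleC \<zeta> (L u) = x)"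

context
  fixes L :: "'a \<Rightarrow> 'a" and x :: 'a and K :: real
  assumes L_add: "\<And>u v. L (u + v) = L u + L v"
    and L_scaleC: "\<And>c u. L (scaleC c u) = scaleC c (L u)"
    and L_bound: "\<And>u. norm (L u) \<le> K * norm u"
    and orbit: "\<And>k. norm ((L ^^ k) x) \<le> 1"
    and spectrum: "operator_spectrum scaleC L \<subseteq> \<real>\<^sub>\<ge>\<^sub>0"
begin

interpretation L: bounded_linear L
proof (rule bounded_linear_intro[of _ K])
  show "L (r *\<^sub>R u) = r *\<^sub>R L u" for r u using L_scaleC[of "of_real r" u] by (simp add: scaleC_of_real)
qed (auto simp: L_add L_bound mult.commute)

lemma neumann_summable:
  assumes "cmod \<zeta> < 1"
  shows "summable (\<lambda>k. norm (scaleC (\<zeta> ^ k) ((L ^^ k) x)))"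
proof (rule summable_comparison_test'[of "\<lambda>k. cmod \<zeta> ^ k" 0])
  show "summable (\<lambda>k. cmod \<zeta> ^ k)" using assms by (simp add: summable_geometric)
  fix k
  have "norm (scaleC (\<zeta> ^ k) ((L ^^ k) x)) \<le> cmod \<zeta> ^ k * 1"
    unfolding norm_scaleC norm_power by (intro mult_left_mono orbit) auto
  then show "norm (norm (scaleC (\<zeta> ^ k) ((L ^^ k) x))) \<le> cmod \<zeta> ^ k" by simp
qed

lemma neumann_solution:
  assumes \<zeta>: "cmod \<zeta> < 1"
  defines "S \<equiv> resolvent_solution L x"
  shows "S \<zeta> - scaleC \<zeta> (L (S \<zeta>)) = x" "norm (S \<zeta>) \<le> 1 / (1 - cmod \<zeta>)"
proof -
  let ?X = "\<lambda>k. scaleC (\<zeta> ^ k) ((L ^^ k) x)"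
  have S: "S \<zeta> = suminf ?X" using \<zeta> by (simp add: S_def resolvent_solution_def)
  have sum: "summable ?X" by (rule summable_norm_cancel[OF neumann_summable[OF \<zeta>]])
  have "scaleC \<zeta> (L (S \<zeta>)) = (\<Sum>k. scaleC \<zeta> (L (?X k)))"
    unfolding S L.suminf[OF sum]
    by (rule bounded_linear.suminf[OF bounded_linear_scaleC L.summable[OF sum]])
  also have "\<dots> = (\<Sum>k. ?X (Suc k))" by (simp add: L_scaleC)
  also have "\<dots> = S \<zeta> - x" unfolding S suminf_split_head[OF sum] by simp
  finally show "S \<zeta> - scaleC \<zeta> (L (S \<zeta>)) = x" by simp
  have "norm (S \<zeta>) \<le> (\<Sum>k. cmod \<zeta> ^ k)" unfolding S
  proof (rule norm_suminf_le)
    show "norm (?X k) \<le> cmod \<zeta> ^ k" for k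
      using mult_left_mono[OF orbit[of k], of "cmod \<zeta> ^ k"] by (simp add: norm_scaleC norm_power)
    show "summable (\<lambda>k. cmod \<zeta> ^ k)" using \<zeta> by (simp add: summable_geometric)
  qed
  then show "norm (S \<zeta>) \<le> 1 / (1 - cmod \<zeta>)" using \<zeta> by (simp add: suminf_geometric)
qed

lemma resolvent_operator:
  assumes \<zeta>: "\<zeta> \<notin> \<real>\<^sub>\<ge>\<^sub>0"
  obtains R where "bounded_linear R" "\<And>c u. R (scaleC c u) = scaleC c (R u)"
    "\<And>u. R (u - scaleC \<zeta> (L u)) = u" "\<And>v. R v - scaleC \<zeta> (L (R v)) = v"
proof -
  have z0: "\<zeta> \<noteq> 0" using \<zeta> by auto
  have "1 / \<zeta> \<notin> \<real>\<^sub>\<ge>\<^sub>0"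
  proof
    assume "1 / \<zeta> \<in> \<real>\<^sub>\<ge>\<^sub>0"
    then obtain r where "1 / \<zeta> = of_real r" "r \<ge> 0" unfolding nonneg_Reals_def by auto
    then have "1 / (1 / \<zeta>) = 1 / of_real r" by (simp only:)
    then have "\<zeta> = of_real (1 / r)" by simp
    then show False using \<zeta> \<open>r \<ge> 0\<close> by (simp add: complex_nonneg_Reals_iff)
  qed
  then have "1 / \<zeta> \<notin> operator_spectrum scaleC L" using spectrum by blast
  then obtain Q where Q: "Vector_Spaces.linear scaleC scaleC Q" "bounded_linear Q"
    "\<And>u. Q (L u - scaleC (1 / \<zeta>) u) = u" "\<And>u. L (Q u) - scaleC (1 / \<zeta>) (Q u) = u"
    unfolding operator_spectrum_def by blast
  have Qs: "Q (scaleC c u) = scaleC c (Q u)" for c u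
    using Q(1) by (simp add: Vector_Spaces.linear_iff)
  define R where "R v = scaleC (- 1 / \<zeta>) (Q v)" for v
  have eq: "u - scaleC \<zeta> (L u) = scaleC (- \<zeta>) (L u - scaleC (1 / \<zeta>) u)" for u
    using z0 by (simp add: scale_right_diff_distrib scale_minus_left)
  show thesis
  proof (rule that[of R])
    show "bounded_linear R"
      unfolding R_def by (rule bounded_linear_compose[OF bounded_linear_scaleC Q(2)])
    show "R (scaleC c u) = scaleC c (R u)" for c u unfolding R_def Qs by (simp add: mult.commute)
    show "R (u - scaleC \<zeta> (L u)) = u" for u
      unfolding eq R_def Qs Q(3) using z0 by simp
    show "R v - scaleC \<zeta> (L (R v)) = v" for v
      unfolding eq R_def L_scaleC
      using Q(4)[of v] z0 by (simp add: scale_right_diff_distrib)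
  qed
qed

lemma resolvent_solution_eq:
  assumes "\<zeta> \<in> ball 0 1 \<union> - \<real>\<^sub>\<ge>\<^sub>0"
  defines "S \<equiv> resolvent_solution L x"
  shows "S \<zeta> - scaleC \<zeta> (L (S \<zeta>)) = x"
proof (cases "cmod \<zeta> < 1")
  case True
  then show ?thesis unfolding S_def by (rule neumann_solution)
next
  case False
  then have "\<zeta> \<notin> \<real>\<^sub>\<ge>\<^sub>0" using assms by auto
  then obtain R where "\<And>v. R v - scaleC \<zeta> (L (R v)) = v" by (rule resolvent_operator) blast
  then have ex: "\<exists>u. u - scaleC \<zeta> (L u) = x" by blast
  have S: "S \<zeta> = (SOME u. u - scaleC \<zeta> (L u) = x)"
    using False by (simp add: S_def resolvent_solution_def)
  show ?thesis unfolding S by (rule someI_ex[OF ex])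
qed

text \<open>The resolvent identity, and the resulting local bound; both the local boundedness and the complex
  differentiability of the solution follow from it.\<close>

lemma resolvent_solution_local:
  assumes \<zeta>0: "\<zeta>0 \<notin> \<real>\<^sub>\<ge>\<^sub>0"
  defines "S \<equiv> resolvent_solution L x"
  obtains R e where "bounded_linear R" "\<And>c u. R (scaleC c u) = scaleC c (R u)" "e > 0"
    "\<And>\<zeta>. \<zeta> \<in> ball \<zeta>0 e \<Longrightarrow> S \<zeta> - S \<zeta>0 = scaleC (\<zeta> - \<zeta>0) (R (L (S \<zeta>)))"
    "\<And>\<zeta>. \<zeta> \<in> ball \<zeta>0 e \<Longrightarrow> norm (S \<zeta>) \<le> 2 * norm (S \<zeta>0)"
proof -
  obtain R where R: "bounded_linear R" "\<And>c u. R (scaleC c u) = scaleC c (R u)"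
    "\<And>u. R (u - scaleC \<zeta>0 (L u)) = u" "\<And>v. R v - scaleC \<zeta>0 (L (R v)) = v"
    by (rule resolvent_operator[OF \<zeta>0]) blast
  obtain C where C: "C > 0" "\<And>u. norm (R (L u)) \<le> norm u * C"
    using bounded_linear.pos_bounded[OF bounded_linear_compose[OF R(1) L.bounded_linear_axioms]] by blast
  obtain e1 where e1: "e1 > 0" "ball \<zeta>0 e1 \<subseteq> - \<real>\<^sub>\<ge>\<^sub>0"
    using \<zeta>0 closed_nonneg_Reals_complex open_contains_ball[of "- \<real>\<^sub>\<ge>\<^sub>0"] by (auto simp: open_Compl)
  define e where "e = min e1 (1 / (2 * C))"
  have e: "e > 0" using e1 C unfolding e_def by simp
  have diff: "S \<zeta> - S \<zeta>0 = scaleC (\<zeta> - \<zeta>0) (R (L (S \<zeta>)))" if "\<zeta> \<in> ball \<zeta>0 e" for \<zeta>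
  proof -
    have "\<zeta> \<in> ball \<zeta>0 e1" using that by (simp add: e_def)
    then have "S \<zeta> - scaleC \<zeta> (L (S \<zeta>)) = x" "S \<zeta>0 - scaleC \<zeta>0 (L (S \<zeta>0)) = x"
      using resolvent_solution_eq[of \<zeta>] resolvent_solution_eq[of \<zeta>0] e1(2) \<zeta>0 unfolding S_def by auto
    then have "S \<zeta> - scaleC \<zeta> (L (S \<zeta>)) = S \<zeta>0 - scaleC \<zeta>0 (L (S \<zeta>0))" by simp
    then have "(S \<zeta> - S \<zeta>0) - scaleC \<zeta>0 (L (S \<zeta> - S \<zeta>0)) = scaleC (\<zeta> - \<zeta>0) (L (S \<zeta>))"
      by (simp add: L.diff scale_right_diff_distrib scale_left_diff_distrib algebra_simps)
    then show ?thesis using R(3)[of "S \<zeta> - S \<zeta>0"] R(2) by metis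
  qed
  have "norm (S \<zeta>) \<le> 2 * norm (S \<zeta>0)" if z: "\<zeta> \<in> ball \<zeta>0 e" for \<zeta>
  proof -
    have "cmod (\<zeta> - \<zeta>0) \<le> 1 / (2 * C)" using z by (simp add: e_def dist_norm norm_minus_commute)
    then have "norm (S \<zeta> - S \<zeta>0) \<le> 1 / (2 * C) * (norm (S \<zeta>) * C)"
      unfolding diff[OF z] norm_scaleC using C by (intro mult_mono) auto
    also have "\<dots> = norm (S \<zeta>) / 2" using C(1) by simp
    finally have "norm (S \<zeta> - S \<zeta>0) \<le> norm (S \<zeta>) / 2" .
    then show ?thesis using norm_triangle_ineq2[of "S \<zeta>" "S \<zeta>0"] by linarith
  qed
  then show thesis using that R(1,2) e diff by blast
qed

lemma resolvent_solution_locally_bounded: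
  assumes "\<zeta> \<in> ball 0 1 \<union> - \<real>\<^sub>\<ge>\<^sub>0"
  shows "\<exists>e>0. \<exists>B. \<forall>w\<in>ball \<zeta> e. norm (resolvent_solution L x w) \<le> B"
proof (cases "\<zeta> \<in> \<real>\<^sub>\<ge>\<^sub>0")
  case False
  then show ?thesis by (rule resolvent_solution_local) blast
next
  case True
  then have z: "cmod \<zeta> < 1" using assms by auto
  define e where "e = (1 - cmod \<zeta>) / 2"
  have "norm (resolvent_solution L x w) \<le> 1 / e" if "w \<in> ball \<zeta> e" for w
  proof -
    have "cmod w - cmod \<zeta> \<le> cmod (\<zeta> - w)" by (metis norm_minus_commute norm_triangle_ineq2)
    then have w: "cmod w \<le> 1 - e" "e > 0" using that z unfolding e_def by (auto simp: dist_norm field_simps)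
    then have "norm (resolvent_solution L x w) \<le> 1 / (1 - cmod w)"
      by (intro neumann_solution(2)) auto
    also have "\<dots> \<le> 1 / e" using w by (intro divide_left_mono) auto
    finally show ?thesis .
  qed
  moreover have "e > 0" using z by (simp add: e_def)
  ultimately show ?thesis by blast
qed

lemma resolvent_solution_holomorphic:
  assumes f: "contractive_functional f"
  shows "(\<lambda>\<zeta>. f (resolvent_solution L x \<zeta>)) holomorphic_on ball 0 1 \<union> - \<real>\<^sub>\<ge>\<^sub>0"
proof (rule holomorphic_on_Un)
  show "open (- \<real>\<^sub>\<ge>\<^sub>0 :: complex set)" using closed_nonneg_Reals_complex by (simp add: open_Compl)
  show "open (ball 0 1 :: complex set)" by simp
  let ?S = "resolvent_solution L x"
  show "(\<lambda>\<zeta>. f (?S \<zeta>)) holomorphic_on ball 0 1"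
  proof (rule power_series_holomorphic)
    fix w :: complex assume "w \<in> ball 0 1"
    then have w: "cmod w < 1" by simp
    have "summable (\<lambda>k. scaleC (w ^ k) ((L ^^ k) x))"
      by (rule summable_norm_cancel[OF neumann_summable[OF w]])
    from contractive_suminf[OF f this]
    show "(\<lambda>n. f ((L ^^ n) x) * (w - 0) ^ n) sums f (?S w)"
      using w contractiveD(2)[OF f] by (simp add: resolvent_solution_def sums_iff mult.commute)
  qed
  show "(\<lambda>\<zeta>. f (?S \<zeta>)) holomorphic_on - \<real>\<^sub>\<ge>\<^sub>0"
  proof (rule holomorphic_onI)
    fix \<zeta>0 :: complex assume "\<zeta>0 \<in> - \<real>\<^sub>\<ge>\<^sub>0"
    then have "\<zeta>0 \<notin> \<real>\<^sub>\<ge>\<^sub>0" by simp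
    then obtain R e where R: "bounded_linear R" "\<And>c u. R (scaleC c u) = scaleC c (R u)" "e > 0"
      "\<And>\<zeta>. \<zeta> \<in> ball \<zeta>0 e \<Longrightarrow> ?S \<zeta> - ?S \<zeta>0 = scaleC (\<zeta> - \<zeta>0) (R (L (?S \<zeta>)))"
      "\<And>\<zeta>. \<zeta> \<in> ball \<zeta>0 e \<Longrightarrow> norm (?S \<zeta>) \<le> 2 * norm (?S \<zeta>0)"
      by (rule resolvent_solution_local) blast
    have RL: "bounded_linear (\<lambda>u. R (L u))"
      by (rule bounded_linear_compose[OF R(1) L.bounded_linear_axioms])
    obtain C where C: "C > 0" "\<And>u. norm (R (L u)) \<le> norm u * C"
      using bounded_linear.pos_bounded[OF RL] by blast
    have ev: "\<forall>\<^sub>F \<zeta> in at \<zeta>0. \<zeta> \<in> ball \<zeta>0 e"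
      using R(3) by (auto simp: eventually_at dist_commute intro!: exI[of _ e])
    have "((\<lambda>\<zeta>. ?S \<zeta> - ?S \<zeta>0) \<longlongrightarrow> 0) (at \<zeta>0)"
    proof (rule Lim_null_comparison)
      show "\<forall>\<^sub>F \<zeta> in at \<zeta>0. norm (?S \<zeta> - ?S \<zeta>0) \<le> cmod (\<zeta> - \<zeta>0) * (2 * norm (?S \<zeta>0) * C)"
        using ev
      proof eventually_elim
        case (elim \<zeta>)
        have "norm (R (L (?S \<zeta>))) \<le> norm (?S \<zeta>) * C" by (rule C)
        also have "\<dots> \<le> 2 * norm (?S \<zeta>0) * C" using R(5)[OF elim] C(1) by (intro mult_right_mono) auto
        finally show ?case unfolding R(4)[OF elim] norm_scaleC by (intro mult_left_mono) auto
      qed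
      show "((\<lambda>\<zeta>. cmod (\<zeta> - \<zeta>0) * (2 * norm (?S \<zeta>0) * C)) \<longlongrightarrow> 0) (at \<zeta>0)"
        by (rule tendsto_eq_intros refl | simp)+
    qed
    then have "(?S \<longlongrightarrow> ?S \<zeta>0) (at \<zeta>0)" by (rule LIM_zero_cancel)
    then have lim: "((\<lambda>\<zeta>. f (R (L (?S \<zeta>)))) \<longlongrightarrow> f (R (L (?S \<zeta>0)))) (at \<zeta>0)"
      by (intro bounded_linear.tendsto[OF contractiveD(8)[OF f]] bounded_linear.tendsto[OF RL])
    have "((\<lambda>\<zeta>. (f (?S \<zeta>) - f (?S \<zeta>0)) / (\<zeta> - \<zeta>0)) \<longlongrightarrow> f (R (L (?S \<zeta>0)))) (at \<zeta>0)"
    proof (rule Lim_transform_eventually[OF lim])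
      show "\<forall>\<^sub>F \<zeta> in at \<zeta>0. f (R (L (?S \<zeta>))) = (f (?S \<zeta>) - f (?S \<zeta>0)) / (\<zeta> - \<zeta>0)"
        using ev eventually_neq_at_within[of \<zeta>0 \<zeta>0]
      proof eventually_elim
        case (elim \<zeta>)
        have "f (?S \<zeta>) - f (?S \<zeta>0) = (\<zeta> - \<zeta>0) * f (R (L (?S \<zeta>)))"
          unfolding contractiveD(7)[OF f, symmetric] R(4)[OF elim(1)] contractiveD(2)[OF f] ..
        then show ?case using elim by simp
      qed
    qed
    then have "((\<lambda>\<zeta>. f (?S \<zeta>)) has_field_derivative f (R (L (?S \<zeta>0)))) (at \<zeta>0)"
      unfolding has_field_derivative_iff .
    then show "(\<lambda>\<zeta>. f (?S \<zeta>)) field_differentiable at \<zeta>0 within - \<real>\<^sub>\<ge>\<^sub>0"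
      using field_differentiable_at_within field_differentiable_def by blast
  qed
qed

end

end


lemma one_plus_nonzero: "1 + w \<noteq> 0" if "cmod w < 1"
proof
  assume "1 + w = 0"
  then have "w = - 1" by (simp add: add_eq_0_iff)
  then show False using that by simp
qed

lemma chebyshev_3_mono:
  fixes c s :: real
  assumes "1 \<le> c" "c \<le> s"
  shows "4 * c ^ 3 - 3 * c \<le> 4 * s ^ 3 - 3 * s"
proof -
  have "1 \<le> c * c" "0 \<le> s * s" "0 \<le> s * c" using assms mult_mono[of 1 c 1 c] by auto
  then have "0 \<le> 4 * (s * s + s * c + c * c) - 3" unfolding distrib_left by linarith
  then have "0 \<le> (s - c) * (4 * (s * s + s * c + c * c) - 3)"
    using assms(2) by (intro mult_nonneg_nonneg) auto
  then show ?thesis by (simp add: algebra_simps power3_eq_cube)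
qed

context JB_star_triple
begin

lemma chebyshev_power_bound:
  assumes x: "norm x \<le> 1" and M: "\<And>u. norm (tp x x u) \<le> M * norm u" "M \<ge> 0"
  shows "norm (chebyshev_power x k) \<le> (4 * M + 3) ^ k"
proof (induction k rule: odd_chebyshev.induct)
  case 1
  then show ?case using x by (simp add: chebyshev_power_0)
next
  case 2
  have "norm (chebyshev_power x (Suc 0)) \<le> 4 * norm (tp x x x) + 3 * norm x"
    unfolding chebyshev_power_1 cube_def
    using norm_triangle_ineq4[of "4 *\<^sub>R tp x x x" "3 *\<^sub>R x"] by simp
  also have "norm (tp x x x) \<le> M * 1" using M(1)[of x] mult_left_mono[OF x M(2)] by linarith
  finally show ?case using x by simp
next
  case (3 k)
  let ?C = "4 * M + 3"
  have "norm (chebyshev_power x (Suc (Suc k)))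
      \<le> norm (4 *\<^sub>R tp x x (chebyshev_power x (Suc k))) + norm (2 *\<^sub>R chebyshev_power x (Suc k))
        + norm (chebyshev_power x k)"
    unfolding chebyshev_power_Suc_Suc
    by (meson add_mono norm_triangle_ineq4 order.refl order.trans)
  also have "\<dots> \<le> 4 * (M * ?C ^ Suc k) + 2 * ?C ^ Suc k + ?C ^ k"
    using 3 M(1)[of "chebyshev_power x (Suc k)"] mult_left_mono[OF 3(1) M(2)]
    by (intro add_mono) auto
  also have "?C ^ k \<le> ?C ^ Suc k" using M(2) by (intro power_increasing) auto
  also have "4 * (M * ?C ^ Suc k) + 2 * ?C ^ Suc k + ?C ^ Suc k = ?C ^ Suc (Suc k)"
    by (simp add: algebra_simps)
  finally show ?case by simp
qed

text \<open>The three-term recursion, summed against \<open>w ^ k\<close> for small \<open>w\<close>.\<close>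

lemma chebyshev_power_generating_function:
  assumes x: "norm x \<le> 1" and M: "\<And>u. norm (tp x x u) \<le> M * norm u" "M \<ge> 0"
    and w: "cmod w * (4 * M + 3) < 1"
  defines "v \<equiv> \<Sum>k. scaleC (w ^ k) (chebyshev_power x k)"
  shows "summable (\<lambda>k. scaleC (w ^ k) (chebyshev_power x k))"
    and "scaleC ((1 + w)\<^sup>2) v - scaleC (4 * w) (tp x x v) = scaleC (1 - w) x"
proof -
  let ?X = "\<lambda>k. scaleC (w ^ k) (chebyshev_power x k)"
  have le: "norm (?X k) \<le> (cmod w * (4 * M + 3)) ^ k" for k
    unfolding norm_scaleC norm_power power_mult_distrib
    by (intro mult_left_mono chebyshev_power_bound x M) auto
  have "norm (cmod w * (4 * M + 3)) < 1" using w M(2) by (simp add: abs_mult)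
  then show sum: "summable ?X"
    by (rule summable_comparison_test'[OF summable_geometric]) (rule le)
  have L: "bounded_linear (tp x x)"
    by (rule bounded_linear_intro[of _ M]) (auto simp: tp_add tp_scaleR M mult.commute)
  have sum1: "summable (\<lambda>k. ?X (Suc k))" and sum2: "summable (\<lambda>k. ?X (Suc (Suc k)))"
    using sum by (simp_all only: summable_Suc_iff[of ?X] summable_Suc_iff[of "\<lambda>k. ?X (Suc k)"])
  have v1: "(\<Sum>k. ?X (Suc k)) = v - x"
    unfolding v_def suminf_split_head[OF sum] by (simp add: chebyshev_power_0)
  have v2: "(\<Sum>k. ?X (Suc (Suc k))) = v - x - scaleC w (chebyshev_power x (Suc 0))"
    unfolding suminf_split_head[OF sum1] v1 by simp
  have eq: "?X (Suc (Suc k)) = scaleC (4 * w) (tp x x (?X (Suc k))) - scaleC (2 * w) (?X (Suc k))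
      - scaleC (w\<^sup>2) (?X k)" for k
    by (simp add: chebyshev_power_Suc_Suc scale_right_diff_distrib tp_scaleC_right
        scaleR_conv_of_real flip: scaleC_of_real) (simp add: power2_eq_square mult_ac)
  have "(\<Sum>k. ?X (Suc (Suc k))) = scaleC (4 * w) (tp x x (v - x)) - scaleC (2 * w) (v - x)
      - scaleC (w\<^sup>2) v"
  proof -
    have a: "(\<lambda>k. ?X (Suc k)) sums (v - x)" using summable_sums[OF sum1] v1 by simp
    have b: "?X sums v" using summable_sums[OF sum] v_def by simp
    have "(\<lambda>k. scaleC (4 * w) (tp x x (?X (Suc k))) - scaleC (2 * w) (?X (Suc k)) - scaleC (w\<^sup>2) (?X k))
        sums (scaleC (4 * w) (tp x x (v - x)) - scaleC (2 * w) (v - x) - scaleC (w\<^sup>2) v)"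
      by (intro sums_diff bounded_linear.sums[OF bounded_linear_scaleC] bounded_linear.sums[OF L] a b)
    then show ?thesis unfolding eq by (simp add: sums_iff)
  qed
  then have "v - x - scaleC w (chebyshev_power x (Suc 0)) = scaleC (4 * w) (tp x x (v - x))
      - scaleC (2 * w) (v - x) - scaleC (w\<^sup>2) v" unfolding v2 .
  moreover have "scaleC w (chebyshev_power x (Suc 0)) = scaleC (4 * w) (tp x x x) - scaleC (3 * w) x"
    by (simp add: chebyshev_power_1 cube_def scale_right_diff_distrib flip: scaleC_of_real)
      (simp add: mult.commute)
  moreover have "(1 + w)\<^sup>2 = 1 + 2 * w + w\<^sup>2" by (simp add: power2_eq_square algebra_simps)
  moreover have "scaleC (3 * w) x = scaleC (2 * w) x + scaleC w x"
    by (simp flip: scale_left_distrib)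
  ultimately show "scaleC ((1 + w)\<^sup>2) v - scaleC (4 * w) (tp x x v) = scaleC (1 - w) x"
    by (simp add: tp_diff scale_right_diff_distrib scale_left_distrib scale_left_diff_distrib algebra_simps)
qed

text \<open>Dividing the previous equation by \<open>(1 + w)^2\<close> turns it into the resolvent equation at
  \<open>\<zeta> = 4 w / (1 + w)^2\<close>. For small \<open>w\<close> the equation has only one solution, since then
  \<open>(1 + w)^2\<close> dominates \<open>4 w L\<close>.\<close>

lemma chebyshev_power_generating_function_eq:
  assumes x: "norm x \<le> 1" and M: "\<And>u. norm (tp x x u) \<le> M * norm u" "M \<ge> 0"
    and w: "cmod w < 1 / (16 * M + 4)"
  shows "(\<Sum>k. scaleC (w ^ k) (chebyshev_power x k))
    = scaleC ((1 - w) / (1 + w)\<^sup>2) (resolvent_solution (tp x x) x (4 * w / (1 + w)\<^sup>2))"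
    (is "?v = ?u")
proof -
  \<comment> \<open>The radius is chosen such that \<open>cmod (1 + w) \<ge> 1/2\<close> while \<open>norm (4 * w * L)\<close> stays below \<open>1/4\<close>.\<close>
  have pos: "16 * M + 4 > 0" using M(2) by simp
  have w1: "cmod w * (16 * M + 4) < 1" using w pos by (simp add: field_simps)
  then have "16 * (cmod w * M) + 4 * cmod w < 1" by (simp add: algebra_simps)
  moreover have "cmod w * (4 * M + 3) = 4 * (cmod w * M) + 3 * cmod w" by (simp add: algebra_simps)
  moreover have "0 \<le> cmod w * M" using M(2) by simp
  ultimately have w2: "cmod w * (4 * M + 3) < 1" "cmod w < 1 / 4" "16 * (cmod w * M) < 1"
    using norm_ge_zero[of w] by linarith+
  have nz: "1 + w \<noteq> 0" by (rule one_plus_nonzero) (use w2 in simp)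
  define z where "z = 4 * w / (1 + w)\<^sup>2"
  have dom: "z \<in> ball 0 1 \<union> - \<real>\<^sub>\<ge>\<^sub>0" unfolding z_def by (rule koebe_in_slit_plane) (use w2 in simp)
  have op: "(tp x x ^^ k) x = odd_power x k" for k unfolding odd_power_def by simp
  have S: "resolvent_solution (tp x x) x z - scaleC z (tp x x (resolvent_solution (tp x x) x z)) = x"
    by (rule resolvent_solution_eq[OF tp_add_right tp_scaleC_right M(1) _ spectrum_L_nonneg dom])
      (simp add: op norm_odd_power_le x)
  define R where "R = resolvent_solution (tp x x) x z"
  define q where "q = (1 - w) / (1 + w)\<^sup>2"
  have q: "(1 + w)\<^sup>2 * q = 1 - w" "4 * w * q = (1 - w) * z" using nz unfolding q_def z_def by auto
  have "scaleC ((1 + w)\<^sup>2) (scaleC q R) - scaleC (4 * w) (tp x x (scaleC q R))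
      = scaleC ((1 + w)\<^sup>2 * q) R - scaleC (4 * w * q) (tp x x R)"
    by (simp only: tp_scaleC_right scale_scale)
  also have "\<dots> = scaleC (1 - w) (R - scaleC z (tp x x R))"
    unfolding q by (simp only: scale_right_diff_distrib scale_scale)
  finally have u: "scaleC ((1 + w)\<^sup>2) (scaleC q R) - scaleC (4 * w) (tp x x (scaleC q R)) = scaleC (1 - w) x"
    unfolding R_def S .
  define V where "V = (\<Sum>k. scaleC (w ^ k) (chebyshev_power x k))"
  have V: "scaleC ((1 + w)\<^sup>2) V - scaleC (4 * w) (tp x x V) = scaleC (1 - w) x"
    unfolding V_def by (rule chebyshev_power_generating_function(2)[OF x M w2(1)])
  define d where "d = V - scaleC q R"
  have "scaleC ((1 + w)\<^sup>2) d - scaleC (4 * w) (tp x x d)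
      = (scaleC ((1 + w)\<^sup>2) V - scaleC (4 * w) (tp x x V))
        - (scaleC ((1 + w)\<^sup>2) (scaleC q R) - scaleC (4 * w) (tp x x (scaleC q R)))"
    unfolding d_def tp_diff scale_right_diff_distrib by (simp only: algebra_simps)
  then have "scaleC ((1 + w)\<^sup>2) d = scaleC (4 * w) (tp x x d)" unfolding u V by simp
  then have "(cmod (1 + w))\<^sup>2 * norm d = 4 * cmod w * norm (tp x x d)"
    using arg_cong[of _ _ norm] by (metis norm_scaleC norm_power norm_mult norm_numeral)
  also have "\<dots> \<le> 4 * cmod w * (M * norm d)" by (intro mult_left_mono M) auto
  finally have 1: "(cmod (1 + w))\<^sup>2 * norm d \<le> 4 * (cmod w * M) * norm d" by (simp add: mult_ac)
  have "1 / 2 \<le> cmod (1 + w)" using norm_triangle_ineq4[of "1 + w" w] w2(2) by simp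
  then have "(1 / 2)\<^sup>2 \<le> (cmod (1 + w))\<^sup>2" by (intro power_mono) auto
  then have "1 / 4 * norm d \<le> (cmod (1 + w))\<^sup>2 * norm d"
    by (intro mult_right_mono) (auto simp: power2_eq_square)
  then have "1 / 4 * norm d \<le> 4 * (cmod w * M) * norm d" using 1 by linarith
  moreover have "4 * (cmod w * M) * norm d < 1 / 4 * norm d" if "norm d > 0"
    using w2(3) that by (intro mult_strict_right_mono) auto
  ultimately have "\<not> 0 < norm d" by linarith
  then have "d = 0" by simp
  then show ?thesis unfolding d_def V_def R_def q_def z_def by simp
qed

text \<open>For a contractive functional \<open>f\<close>, the scalar function \<open>g\<close> below is holomorphic on the unit disc,
  and its Taylor coefficients at \<open>0\<close> are the values of \<open>f\<close> at the Chebyshev powers. Cauchy's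
  inequality on the circle of radius \<open>r\<close> bounds them uniformly in \<open>f\<close>, because the resolvent
  solution is bounded on the compact image of this circle.\<close>

lemma chebyshev_power_subexponential:
  assumes x: "norm x \<le> 1" and r: "0 < r" "r < 1"
  obtains B where "\<And>k. norm (chebyshev_power x k) * r ^ k \<le> B"
proof -
  obtain M' where M': "M' > 0" "\<And>x y z. norm (tp x y z) \<le> M' * norm x * norm y * norm z"
    by (rule tp_bounded) blast
  define M where "M = M' * norm x * norm x"
  have M: "\<And>u. norm (tp x x u) \<le> M * norm u" "M \<ge> 0" using M' unfolding M_def by auto
  let ?S = "resolvent_solution (tp x x) x" and ?\<zeta> = "\<lambda>w::complex. 4 * w / (1 + w)\<^sup>2"
  have op: "(tp x x ^^ k) x = odd_power x k" for k unfolding odd_power_def by simp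
  have orbit: "norm ((tp x x ^^ k) x) \<le> 1" for k by (simp add: op norm_odd_power_le x)
  note ctx = tp_add_right tp_scaleC_right M(1) orbit spectrum_L_nonneg
  note nz = one_plus_nonzero
  have koebe: "z \<in> ball 0 1 \<union> - \<real>\<^sub>\<ge>\<^sub>0" if z: "z \<in> ?\<zeta> ` sphere 0 r" for z
  proof -
    obtain w where "z = ?\<zeta> w" "cmod w = r" using z by auto
    then show ?thesis using koebe_in_slit_plane[of w] r by simp
  qed
  have "compact (?\<zeta> ` sphere 0 r)"
    by (intro compact_continuous_image continuous_intros) (use nz r in auto)
  moreover have "\<exists>e>0. \<exists>B. \<forall>w\<in>ball z e. norm (?S w) \<le> B" if "z \<in> ?\<zeta> ` sphere 0 r" for z
    by (rule resolvent_solution_locally_bounded[OF ctx koebe[OF that]])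
  ultimately obtain B where B: "\<And>z. z \<in> ?\<zeta> ` sphere 0 r \<Longrightarrow> norm (?S z) \<le> B"
    using locally_bounded_imp_bounded_on_compact[of "?\<zeta> ` sphere 0 r" "\<lambda>z. norm (?S z)"] by blast
  define D where "D = 2 / (1 - r)\<^sup>2 * B"
  have "norm (chebyshev_power x k) \<le> D / r ^ k" for k
  proof (rule norm_le_if_contractive_le)
    fix f assume f: "contractive_functional f"
    define g where "g w = (1 - w) / (1 + w)\<^sup>2 * f (?S (?\<zeta> w))" for w
    have "(f \<circ> ?S) \<circ> ?\<zeta> holomorphic_on ball 0 1"
    proof (rule holomorphic_on_compose_gen)
      show "?\<zeta> holomorphic_on ball 0 1" by (intro holomorphic_intros) (use nz in auto)
      show "f \<circ> ?S holomorphic_on ball 0 1 \<union> - \<real>\<^sub>\<ge>\<^sub>0"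
        using resolvent_solution_holomorphic[OF ctx f] by (simp add: o_def)
      show "?\<zeta> ` ball 0 1 \<subseteq> ball 0 1 \<union> - \<real>\<^sub>\<ge>\<^sub>0"
        by (intro image_subsetI koebe_in_slit_plane) simp
    qed
    then have "(\<lambda>w. f (?S (?\<zeta> w))) holomorphic_on ball 0 1" by (simp add: o_def)
    then have hol: "g holomorphic_on ball 0 1"
      unfolding g_def by (intro holomorphic_intros) (use nz in auto)
    define F where "F = Abs_fps (\<lambda>k. f (chebyshev_power x k))"
    define \<rho> where "\<rho> = 1 / (16 * M + 4)"
    have \<rho>: "\<rho> > 0" using M(2) unfolding \<rho>_def by simp
    have sums: "(\<lambda>k. f (chebyshev_power x k) * w ^ k) sums g w" if w: "cmod w < \<rho>" for w
    proof -
      have "cmod w * (16 * M + 4) < 1" using w M(2) unfolding \<rho>_def by (simp add: field_simps)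
      moreover have "cmod w * (4 * M + 3) \<le> cmod w * (16 * M + 4)"
        using M(2) by (intro mult_left_mono) auto
      ultimately have "cmod w * (4 * M + 3) < 1" by linarith
      note sum = chebyshev_power_generating_function(1)[OF x M this]
      have "f (\<Sum>k. scaleC (w ^ k) (chebyshev_power x k)) = g w"
        unfolding chebyshev_power_generating_function_eq[OF x M w[unfolded \<rho>_def]] contractiveD(2)[OF f]
          g_def ..
      then show ?thesis
        using contractive_suminf[OF f sum] contractiveD(2)[OF f] by (simp add: sums_iff mult.commute)
    qed
    have "g has_fps_expansion F"
      unfolding has_fps_expansion_def
    proof
      have "norm (of_real (\<rho> / 2) :: complex) \<le> conv_radius (fps_nth F)"
        by (rule conv_radius_geI)
          (use sums[of "of_real (\<rho> / 2)"] \<rho> in \<open>auto simp: F_def sums_iff\<close>)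
      then show "0 < fps_conv_radius F"
        unfolding fps_conv_radius_def using \<rho> by (auto intro: less_le_trans[rotated])
      show "\<forall>\<^sub>F z in nhds 0. eval_fps F z = g z"
        unfolding eventually_nhds_metric
        by (rule exI[of _ \<rho>]) (use sums \<rho> in \<open>auto simp: eval_fps_def F_def sums_iff\<close>)
    qed
    then have "f (chebyshev_power x k) = (deriv ^^ k) g 0 / fact k"
      using fps_nth_fps_expansion[of g F k] by (simp add: F_def)
    moreover have "cmod ((deriv ^^ k) g 0) \<le> fact k * D / r ^ k"
    proof (rule Cauchy_inequality)
      show "g holomorphic_on ball 0 r"
        using hol by (rule holomorphic_on_subset) (use r in auto)
      show "continuous_on (cball 0 r) g"
        by (rule continuous_on_subset[OF holomorphic_on_imp_continuous_on[OF hol]]) (use r in auto)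
      show "cmod (g w) \<le> D" if "norm (0 - w) = r" for w
      proof -
        have w: "cmod w = r" using that by simp
        have "cmod (f (?S (?\<zeta> w))) \<le> B"
          using contractiveD(3)[OF f] B w by (meson imageI mem_sphere_0 order.trans)
        moreover have "cmod (1 - w) \<le> 2" using norm_triangle_ineq4[of 1 w] w r by simp
        moreover have "(1 - r)\<^sup>2 \<le> (cmod (1 + w))\<^sup>2"
          using norm_triangle_ineq4[of "1 + w" w] w r by (intro power_mono) auto
        ultimately show ?thesis unfolding g_def D_def norm_mult norm_divide norm_power
          using r by (intro mult_mono frac_le) auto
      qed
    qed (use r in auto)
    ultimately show "cmod (f (chebyshev_power x k)) \<le> D / r ^ k"
      using divide_right_mono[of "cmod ((deriv ^^ k) g 0)" "fact k * D / r ^ k" "fact k"]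
      by (simp add: norm_divide)
  qed
  then have "norm (chebyshev_power x k) * r ^ k \<le> D" for k
    using r by (simp add: pos_le_divide_eq)
  then show thesis using that by blast
qed

text \<open>If the norm \<open>s\<close> of the \<open>k\<close>-th Chebyshev power is \<open>cosh \<theta> > 1\<close>, the cube identity shows that the
  Chebyshev power of index \<open>3 k + 1\<close> has norm at least \<open>4 s^3 - 3 s = cosh (3 \<theta>)\<close>. Iterating
  triples the angle together with the degree, which contradicts subexponential growth.\<close>

lemma norm_chebyshev_3_le:
  assumes x: "norm x \<le> 1" shows "norm (4 *\<^sub>R cube x - 3 *\<^sub>R x) \<le> 1"
proof (rule ccontr)
  let ?s = "\<lambda>k. norm (chebyshev_power x k)"
  assume "\<not> norm (4 *\<^sub>R cube x - 3 *\<^sub>R x) \<le> 1"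
  then have s1: "?s 1 > 1" by (simp add: chebyshev_power_1)
  define \<theta> where "\<theta> = arcosh (?s 1)"
  have c: "cosh \<theta> = ?s 1" using s1 unfolding \<theta>_def by (intro cosh_arcosh_real) simp
  have \<theta>: "\<theta> > 0" using s1 unfolding \<theta>_def by (intro arcosh_real_gt_1_iff[THEN iffD2] | simp)+
  \<comment> \<open>The Chebyshev power of index \<open>k n\<close> has degree \<open>3 ^ (n + 1)\<close>.\<close>
  define k where "k n = ((\<lambda>j. 3 * j + 1) ^^ n) (1::nat)" for n
  have k: "k 0 = 1" "k (Suc n) = 3 * k n + 1" for n by (auto simp: k_def)
  have k_le: "k n \<le> 2 * 3 ^ n" for n
  proof -
    have "k n + 1 \<le> 2 * 3 ^ n" by (induction n) (auto simp: k)
    then show ?thesis by simp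
  qed
  have grow: "cosh (3 ^ n * \<theta>) \<le> ?s (k n)" for n
  proof (induction n)
    case 0 then show ?case by (simp add: k c)
  next
    case (Suc n)
    let ?c = "cosh (3 ^ n * \<theta>)"
    have "4 * ?s (k n) ^ 3 = norm (chebyshev_power x (3 * k n + 1) + 3 *\<^sub>R chebyshev_power x (k n))"
      unfolding cube_chebyshev_power[symmetric] by (simp add: norm_cube_eq)
    also have "\<dots> \<le> ?s (3 * k n + 1) + 3 * ?s (k n)"
      using norm_triangle_ineq[of "chebyshev_power x (3 * k n + 1)" "3 *\<^sub>R chebyshev_power x (k n)"] by simp
    finally have 1: "4 * ?s (k n) ^ 3 - 3 * ?s (k n) \<le> ?s (k (Suc n))" by (simp add: k)
    have c1: "?c \<ge> 1" by (rule cosh_real_ge_1)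
    have "4 * ?c ^ 3 - 3 * ?c \<le> 4 * ?s (k n) ^ 3 - 3 * ?s (k n)"
      by (rule chebyshev_3_mono[OF c1 Suc])
    also have "4 * ?c ^ 3 - 3 * ?c = cosh (3 * (3 ^ n * \<theta>))"
      unfolding cosh_def by (simp add: field_simps power3_eq_cube exp_minus flip: exp_add) 
    finally show ?case using 1 by (simp add: mult_ac)
  qed
  \<comment> \<open>The index after \<open>n\<close> steps is at most \<open>2 * 3 ^ n\<close>, so this radius loses only half of the exponent \<open>3 ^ n * \<theta>\<close>.\<close>
  define r where "r = exp (- \<theta> / 4)"
  have r: "0 < r" "r < 1" using \<theta> unfolding r_def by auto
  obtain B where B: "\<And>k. norm (chebyshev_power x k) * r ^ k \<le> B"
    by (rule chebyshev_power_subexponential[OF x r]) blast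
  have "exp (\<theta> / 2) ^ (3 ^ n) \<le> 2 * B" for n
  proof -
    have "r ^ (2 * 3 ^ n) \<le> r ^ k n" using r k_le by (intro power_decreasing) auto
    then have "cosh (3 ^ n * \<theta>) * r ^ (2 * 3 ^ n) \<le> ?s (k n) * r ^ k n"
      using grow r by (intro mult_mono) auto
    also have "\<dots> \<le> B" by (rule B)
    finally have "cosh (3 ^ n * \<theta>) * r ^ (2 * 3 ^ n) \<le> B" .
    moreover have "exp (3 ^ n * \<theta>) / 2 \<le> cosh (3 ^ n * \<theta>)" unfolding cosh_def by simp
    then have "exp (3 ^ n * \<theta>) / 2 * r ^ (2 * 3 ^ n) \<le> cosh (3 ^ n * \<theta>) * r ^ (2 * 3 ^ n)"
      using r by (intro mult_right_mono) auto
    moreover have "exp (3 ^ n * \<theta>) * r ^ (2 * 3 ^ n) = exp (\<theta> / 2) ^ (3 ^ n)"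
      unfolding r_def exp_of_nat_mult[symmetric] exp_add[symmetric] by (simp add: field_simps)
    ultimately show ?thesis by simp
  qed
  then have "exp (\<theta> / 2) \<le> 1" by (rule tripled_powers_bounded_imp_le_1)
  then show False using \<theta> by simp
qed

end


section \<open>Derivations are dissipative\<close>

lemma linear_term_zero_if_quadratic_bound:
  fixes a :: real
  assumes e: "e > 0" and bound: "\<And>t. \<bar>t\<bar> \<le> e \<Longrightarrow> t * a \<le> C * t\<^sup>2"
  shows "a = 0"
proof -
  have le: "\<bar>a\<bar> \<le> \<bar>C\<bar> * t" if t: "0 < t" "t \<le> e" for t
  proof -
    have "t * a \<le> C * t\<^sup>2" "- t * a \<le> C * (- t)\<^sup>2"
      using bound[of t] bound[of "- t"] t by auto
    then have "t * \<bar>a\<bar> \<le> C * t\<^sup>2" by (auto simp: abs_if)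
    also have "\<dots> \<le> \<bar>C\<bar> * t\<^sup>2" by (intro mult_right_mono) auto
    finally have "t * \<bar>a\<bar> \<le> t * (\<bar>C\<bar> * t)" by (simp add: power2_eq_square mult_ac)
    then show ?thesis using t(1) by simp
  qed
  have "\<bar>a\<bar> \<le> 0"
  proof (rule tendsto_lowerbound)
    show "((\<lambda>t. \<bar>C\<bar> * t) \<longlongrightarrow> 0) (at_right 0)"
      by (rule tendsto_eq_intros refl | simp)+
    show "\<forall>\<^sub>F t in at_right 0. \<bar>a\<bar> \<le> \<bar>C\<bar> * t"
      using le e by (auto simp: eventually_at_right_field intro!: exI[of _ e])
  qed simp
  then show ?thesis by simp
qed

definition nonneg_poly :: "real poly \<Rightarrow> bool" where
  "nonneg_poly p \<longleftrightarrow> (\<forall>i. coeff p i \<ge> 0)"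

lemma nonneg_poly_add: "nonneg_poly p \<Longrightarrow> nonneg_poly q \<Longrightarrow> nonneg_poly (p + q)"
  and nonneg_poly_mult: "nonneg_poly p \<Longrightarrow> nonneg_poly q \<Longrightarrow> nonneg_poly (p * q)"
  and nonneg_poly_smult: "c \<ge> 0 \<Longrightarrow> nonneg_poly p \<Longrightarrow> nonneg_poly (smult c p)"
  and nonneg_poly_pCons: "c \<ge> 0 \<Longrightarrow> nonneg_poly p \<Longrightarrow> nonneg_poly (pCons c p)"
  and nonneg_poly_0: "nonneg_poly 0"
  by (auto simp: nonneg_poly_def coeff_mult coeff_pCons intro!: sum_nonneg split: nat.split)

text \<open>Fixed point iteration for \<open>y = (2 x + y^3) / 3\<close>, which is the equation \<open>(3 y - y^3) / 2 = x\<close>;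
  the polynomials are divided by their variable and expressed in its square. The iterates
  have nonnegative, increasing coefficients, and their values at \<open>1\<close> stay below the fixed point \<open>1\<close>
  of the scalar iteration \<open>s \<mapsto> (2 + s^3) / 3\<close>.\<close>

fun plateau_iterate :: "nat \<Rightarrow> real poly" where
  "plateau_iterate 0 = 0"
| "plateau_iterate (Suc n) = smult (1/3) (pCons 2 (plateau_iterate n ^ 3))"

lemma nonneg_plateau_iterate: "nonneg_poly (plateau_iterate n)"
  by (induction n)
     (auto intro!: nonneg_poly_0 nonneg_poly_smult nonneg_poly_pCons nonneg_poly_mult simp: power3_eq_cube)

lemma nonneg_plateau_iterate_step: "nonneg_poly (plateau_iterate (Suc n) - plateau_iterate n)"
proof (induction n)
  case 0
  then show ?case by (auto intro!: nonneg_poly_0 nonneg_poly_pCons)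
next
  case (Suc n)
  let ?a = "plateau_iterate (Suc n)" and ?b = "plateau_iterate n"
  have cubes: "p ^ 3 - q ^ 3 = (p - q) * (p * p + p * q + q * q)" for p q :: "real poly"
    by (simp add: power3_eq_cube algebra_simps)
  have "plateau_iterate (Suc (Suc n)) - ?a = smult (1/3) (pCons 0 (?a ^ 3 - ?b ^ 3))"
  proof -
    have "smult (1/3) (pCons 2 p) - smult (1/3) (pCons 2 q) = smult (1/3) (pCons 0 (p - q))"
      for p q :: "real poly"
      by (simp flip: smult_diff_right)
    from this[of "?a ^ 3" "?b ^ 3"] show ?thesis
      by (simp only: plateau_iterate.simps(2)[of "Suc n"] plateau_iterate.simps(2)[of n])
  qed
  also have "?a ^ 3 - ?b ^ 3 = (?a - ?b) * (?a * ?a + ?a * ?b + ?b * ?b)"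
    by (rule cubes)
  also have "nonneg_poly (smult (1/3) (pCons 0 \<dots>))"
    using Suc by (intro nonneg_poly_smult nonneg_poly_pCons nonneg_poly_mult nonneg_poly_add
        nonneg_plateau_iterate) auto
  finally show ?case .
qed

lemma nonneg_plateau_iterate_diff:
  "m \<le> n \<Longrightarrow> nonneg_poly (plateau_iterate n - plateau_iterate m)"
proof (induction n rule: dec_induct)
  case base then show ?case by (simp add: nonneg_poly_0)
next
  case (step n)
  then show ?case
    using nonneg_poly_add[OF step(3) nonneg_plateau_iterate_step[of n]] by simp
qed

lemma plateau_iterate_at_1: "0 \<le> poly (plateau_iterate n) 1" "poly (plateau_iterate n) 1 \<le> 1"
proof (induction n)
  case (Suc n)
  case 1 then show ?case using Suc by simp
  case 2 then show ?case using Suc power_le_one[OF Suc, of 3] by simp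
qed auto

context JB_star_triple
begin

text \<open>For nonnegative coefficients the sum of the coefficients dominates the norm, since the odd powers
  of \<open>x\<close> lie in the unit ball.\<close>

lemma norm_odd_eval_le:
  assumes "norm x \<le> 1" "nonneg_poly p"
  shows "norm (odd_eval x p n) \<le> poly p 1"
proof -
  have "norm (odd_eval x p n) \<le> (\<Sum>i\<le>degree p. norm (coeff p i *\<^sub>R odd_power x (i + n)))"
    unfolding odd_eval_def by (rule norm_sum)
  also have "\<dots> \<le> (\<Sum>i\<le>degree p. coeff p i * 1)"
  proof (intro sum_mono)
    fix i
    have "norm (coeff p i *\<^sub>R odd_power x (i + n)) = coeff p i * norm (odd_power x (i + n))"
      using assms(2) by (simp add: nonneg_poly_def)
    also have "\<dots> \<le> coeff p i * 1"
      using assms by (intro mult_left_mono norm_odd_power_le) (auto simp: nonneg_poly_def)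
    finally show "norm (coeff p i *\<^sub>R odd_power x (i + n)) \<le> coeff p i * 1" .
  qed
  also have "\<dots> = poly p 1" by (simp add: poly_altdef)
  finally show ?thesis .
qed

text \<open>The functional calculus of \<open>(3 s - s^3) / 2\<close>, which has a critical point at \<open>s = 1\<close> with value
  \<open>1\<close>.\<close>

definition plateau :: "'a \<Rightarrow> 'a" where
  "plateau u = (1/2) *\<^sub>R (3 *\<^sub>R u - cube u)"

lemma norm_plateau_le:
  assumes "norm u \<le> 2" shows "norm (plateau u) \<le> 1"
proof -
  have "4 *\<^sub>R cube ((1/2) *\<^sub>R u) - 3 *\<^sub>R ((1/2) *\<^sub>R u) = - plateau u"
    by (simp add: cube_def tp_scaleR plateau_def scaleR_diff_right)
  then show ?thesis using norm_chebyshev_3_le[of "(1/2) *\<^sub>R u"] assms by simp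
qed

text \<open>The coefficients of the iterates increase, so the distance between two iterates is at most the
  difference of their scalar counterparts, which converge. The limit stays in \<open>E\<close>, as the iterates
  are real combinations of odd powers of \<open>x\<close>.\<close>

lemma plateau_surjective:
  assumes E: "Real_Vector_Spaces.subspace E" "closed E" "\<And>a b c. a \<in> E \<Longrightarrow> b \<in> E \<Longrightarrow> c \<in> E \<Longrightarrow> tp a b c \<in> E"
    and x: "x \<in> E" "norm x \<le> 1"
  obtains y where "y \<in> E" "norm y \<le> 1" "plateau y = x"
proof -
  define y where "y n = odd_eval x (plateau_iterate n) 0" for n
  define s where "s n = poly (plateau_iterate n) 1" for n
  have y_Suc: "y (Suc n) = (1/3) *\<^sub>R (2 *\<^sub>R x + cube (y n))" for n
    unfolding y_def cube_odd_eval by (simp add: odd_eval_smult odd_eval_pCons scaleR_add_right)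
  have dist: "norm (y n - y m) \<le> s n - s m" if "m \<le> n" for m n
    using norm_odd_eval_le[OF x(2) nonneg_plateau_iterate_diff[OF that], of 0]
    by (simp add: y_def s_def odd_eval_diff)
  have "mono s"
    using dist by (intro monoI) (metis diff_ge_0_iff_ge norm_ge_zero order.trans)
  moreover have "s n \<le> 1" for n using plateau_iterate_at_1 by (simp add: s_def)
  ultimately obtain l where "s \<longlonglongrightarrow> l" by (auto intro: incseq_convergent[of s 1])
  then have "convergent s" by (rule convergentI)
  then have "Cauchy s" by (rule convergent_Cauchy)
  have "Cauchy y"
  proof (rule metric_CauchyI)
    fix e :: real assume "e > 0"
    then obtain N where N: "\<And>m n. m \<ge> N \<Longrightarrow> n \<ge> N \<Longrightarrow> dist (s m) (s n) < e"
      using metric_CauchyD[OF \<open>Cauchy s\<close>] by blast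
    have "dist (y m) (y n) < e" if "m \<ge> N" "n \<ge> N" for m n
    proof (cases "m \<le> n")
      case True
      then show ?thesis using dist[OF True] N[OF that]
        by (simp add: dist_norm norm_minus_commute abs_if split: if_splits)
    next
      case False
      then show ?thesis using dist[of n m] N[OF that]
        by (simp add: dist_norm abs_if split: if_splits)
    qed
    then show "\<exists>M. \<forall>m\<ge>M. \<forall>n\<ge>M. dist (y m) (y n) < e" by blast
  qed
  then obtain z where z: "y \<longlonglongrightarrow> z" using Cauchy_convergent convergent_def by blast
  have "(\<lambda>n. y (Suc n)) \<longlonglongrightarrow> (1/3) *\<^sub>R (2 *\<^sub>R x + cube z)"
    unfolding y_Suc cube_def by (intro tendsto_intros tp_tendsto z)
  then have "z = (1/3) *\<^sub>R (2 *\<^sub>R x + cube z)"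
    using LIMSEQ_Suc[OF z] LIMSEQ_unique by blast
  then have "3 *\<^sub>R z = 3 *\<^sub>R ((1/3) *\<^sub>R (2 *\<^sub>R x + cube z))" by (simp only:)
  then have "plateau z = x" by (simp add: plateau_def)
  moreover have "norm z \<le> 1"
  proof (rule tendsto_upperbound[OF tendsto_norm[OF z]])
    show "\<forall>\<^sub>F n in sequentially. norm (y n) \<le> 1"
      using norm_odd_eval_le[OF x(2) nonneg_plateau_iterate] plateau_iterate_at_1(2)
      by (auto simp: y_def intro!: always_eventually intro: order.trans)
  qed simp
  moreover have "z \<in> E"
  proof (rule closed_sequentially[OF E(2) _ z])
    have "odd_power x k \<in> E" for k
      by (induction k) (auto simp: odd_power_Suc x(1) intro!: E(3))
    then show "y n \<in> E" for n
      using E(1) by (auto simp: y_def odd_eval_def intro!: real_vector.subspace_sum real_vector.subspace_scale)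
  qed
  ultimately show thesis using that by blast
qed

text \<open>The curve \<open>t \<mapsto> plateau (y + t v)\<close> stays in the unit ball for small \<open>t\<close> of either sign, so its
  velocity at \<open>t = 0\<close> has vanishing real part under a functional that supports its starting point.\<close>

lemma supports_plateau_tangent:
  assumes y: "norm y \<le> 1" and f: "supports f (plateau y)"
  shows "Re (f (3 *\<^sub>R v - 2 *\<^sub>R tp v y y - tp y v y)) = 0"
proof -
  have cf: "contractive_functional f" and f1: "f (plateau y) = 1"
    using f unfolding supports_def by auto
  note fD = contractiveD[OF cf]
  define a where "a = Re (f (3 *\<^sub>R v - 2 *\<^sub>R tp v y y - tp y v y))"
  define b where "b = Re (f (2 *\<^sub>R tp v v y + tp v y v))"
  define c where "c = Re (f (cube v))"
  have expand: "plateau (y + t *\<^sub>R v) = plateau y + (t / 2) *\<^sub>R (3 *\<^sub>R v - 2 *\<^sub>R tp v y y - tp y v y)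
      - (t\<^sup>2 / 2) *\<^sub>R (2 *\<^sub>R tp v v y + tp v y v) - (t ^ 3 / 2) *\<^sub>R cube v" for t
  proof -
    have sym: "tp y y v = tp v y y" "tp y v v = tp v v y" by (rule tp_symmetric)+
    have "cube (y + t *\<^sub>R v) = cube y + t *\<^sub>R (2 *\<^sub>R tp v y y + tp y v y)
        + t\<^sup>2 *\<^sub>R (2 *\<^sub>R tp v v y + tp v y v) + t ^ 3 *\<^sub>R cube v"
      unfolding cube_def by (simp add: tp_add tp_scaleR sym scaleR_add_right scaleR_2
          power2_eq_square power3_eq_cube add_ac)
    then show ?thesis
      by (simp add: plateau_def algebra_simps)
  qed
  have "t * (a / 2) \<le> (\<bar>b\<bar> / 2 + \<bar>c\<bar> / 2) * t\<^sup>2" if t: "\<bar>t\<bar> \<le> 1 / (1 + norm v)" for t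
  proof -
    have v1: "0 < 1 + norm v" by (simp add: add_pos_nonneg)
    have "\<bar>t\<bar> * (1 + norm v) \<le> 1" using t v1 by (simp add: pos_le_divide_eq)
    moreover have "\<bar>t\<bar> * (1 + norm v) = \<bar>t\<bar> + \<bar>t\<bar> * norm v" by (simp add: algebra_simps)
    moreover have "0 \<le> \<bar>t\<bar> * norm v" by simp
    ultimately have t1: "\<bar>t\<bar> * norm v \<le> 1" "\<bar>t\<bar> \<le> 1"
      using abs_ge_zero[of t] by linarith+
    have "norm (y + t *\<^sub>R v) \<le> 2" using norm_triangle_ineq[of y "t *\<^sub>R v"] y t1 by simp
    then have "Re (f (plateau (y + t *\<^sub>R v))) \<le> 1"
      using norm_plateau_le fD(3) complex_Re_le_cmod by (meson order.trans)
    also have "Re (f (plateau (y + t *\<^sub>R v))) = 1 + t / 2 * a - t\<^sup>2 / 2 * b - t ^ 3 / 2 * c"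
      unfolding expand a_def b_def c_def fD(7) fD(1)[of "plateau y"] fD(4) f1 by simp
    finally have "t * (a / 2) \<le> t\<^sup>2 * (b / 2) + t ^ 3 * (c / 2)" by simp
    also have "t\<^sup>2 * (b / 2) \<le> t\<^sup>2 * (\<bar>b\<bar> / 2)" by (intro mult_left_mono) auto
    also have "t ^ 3 * (c / 2) \<le> \<bar>t ^ 3 * (c / 2)\<bar>" by (rule abs_ge_self)
    also have "\<dots> = t\<^sup>2 * (\<bar>t\<bar> * (\<bar>c\<bar> / 2))"
    proof -
      have "\<bar>t ^ 3 * (c / 2)\<bar> = \<bar>t\<bar> ^ 3 * (\<bar>c\<bar> / 2)" by (simp add: abs_mult power_abs)
      also have "\<bar>t\<bar> ^ 3 = t\<^sup>2 * \<bar>t\<bar>" by (simp add: power3_eq_cube power2_eq_square)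
      finally show ?thesis by (simp only: mult.assoc)
    qed
    also have "\<dots> \<le> t\<^sup>2 * (1 * (\<bar>c\<bar> / 2))" using t1 by (intro mult_left_mono mult_right_mono) auto
    finally show ?thesis by (simp add: algebra_simps)
  qed
  moreover have "1 / (1 + norm v) > 0" by (simp add: add_pos_nonneg)
  ultimately have "a / 2 = 0" by (rule linear_term_zero_if_quadratic_bound[rotated])
  then show ?thesis by (simp add: a_def)
qed

text \<open>With \<open>x = plateau y\<close>, the product rule turns \<open>\<delta> x\<close> into the velocity of the curve
  \<open>plateau (y + t \<delta> y)\<close>.\<close>

lemma real_triple_derivation_dissipative:
  assumes E: "real_JB_star_triple scaleC tp E" and \<delta>: "triple_derivation scaleR tp E \<delta>"
    and x: "x \<in> E" and f: "supports f x"
  shows "Re (f (\<delta> x)) = 0"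
proof -
  have E': "Real_Vector_Spaces.subspace E" "closed E" "\<And>a b c. a \<in> E \<Longrightarrow> b \<in> E \<Longrightarrow> c \<in> E \<Longrightarrow> tp a b c \<in> E"
    using E unfolding real_JB_star_triple_def by auto
  have \<delta>D: "\<delta> (u + v) = \<delta> u + \<delta> v" "\<delta> (r *\<^sub>R u) = r *\<^sub>R \<delta> u"
    "\<delta> (tp u u u) = tp (\<delta> u) u u + tp u (\<delta> u) u + tp u u (\<delta> u)" if "u \<in> E" "v \<in> E" for u v r
    using \<delta> that unfolding triple_derivation_def linear_self_map_on_def by blast+
  obtain y where y: "y \<in> E" "norm y \<le> 1" "plateau y = x"
    by (rule plateau_surjective[OF E' x]) (use f in \<open>auto simp: supports_def\<close>)
  have cE: "tp y y y \<in> E" using E'(3) y(1) by blast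
  have mE: "3 *\<^sub>R y \<in> E" "(-1) *\<^sub>R tp y y y \<in> E" 
    by (rule real_vector.subspace_scale[OF E'(1) y(1)], rule real_vector.subspace_scale[OF E'(1) cE])
  have sE: "3 *\<^sub>R y + (-1) *\<^sub>R tp y y y \<in> E" by (rule real_vector.subspace_add[OF E'(1) mE])
  have "x = (1/2) *\<^sub>R (3 *\<^sub>R y + (-1) *\<^sub>R tp y y y)" using y(3) by (simp add: plateau_def cube_def)
  then have "\<delta> x = (1/2) *\<^sub>R (3 *\<^sub>R \<delta> y + (-1) *\<^sub>R (tp (\<delta> y) y y + tp y (\<delta> y) y + tp y y (\<delta> y)))"
    by (simp only: \<delta>D(2)[OF sE sE] \<delta>D(1)[OF mE] \<delta>D(2)[OF y(1) y(1)] \<delta>D(2)[OF cE cE] \<delta>D(3)[OF y(1) y(1)])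
  then have dx: "\<delta> x = (1/2) *\<^sub>R (3 *\<^sub>R \<delta> y - 2 *\<^sub>R tp (\<delta> y) y y - tp y (\<delta> y) y)"
    by (simp add: tp_symmetric[of y y "\<delta> y"] scaleR_2 algebra_simps)
  have cf: "contractive_functional f" using f unfolding supports_def by auto
  show ?thesis
    using supports_plateau_tangent[OF y(2), of f "\<delta> y"] f y(3) unfolding dx contractiveD(4)[OF cf] by simp
qed

lemma real_local_triple_derivation_dissipative:
  assumes E: "real_JB_star_triple scaleC tp E" and T: "local_triple_derivation scaleR tp E T"
    and x: "x \<in> E" and f: "supports f x"
  shows "Re (f (T x)) = 0"
proof -
  obtain \<delta> where "triple_derivation scaleR tp E \<delta>" "T x = \<delta> x"
    using T x unfolding local_triple_derivation_def by blast
  then show ?thesis using real_triple_derivation_dissipative[OF E _ x f] by simp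
qed

lemma dissipative_norm_le:
  assumes "\<And>f. supports f ((1 / norm x) *\<^sub>R x) \<Longrightarrow> Re (f v) = 0"
  shows "norm x \<le> norm (x - v)"
proof (cases "x = 0")
  case False
  then obtain f where f: "supports f ((1 / norm x) *\<^sub>R x)"
    using supporting_functional[of "(1 / norm x) *\<^sub>R x"] by auto
  then have cf: "contractive_functional f" and "f ((1 / norm x) *\<^sub>R x) = 1"
    unfolding supports_def by auto
  then have "of_real (1 / norm x) * f x = 1" by (simp only: contractiveD(4)[OF cf])
  then have "f x = of_real (norm x)" using False by (simp add: field_simps)
  then have "norm x = Re (f (x - v))"
    using assms[OF f] by (simp add: contractiveD(7)[OF cf])
  also have "\<dots> \<le> norm (x - v)"
    using complex_Re_le_cmod contractiveD(3)[OF cf] order.trans by blast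
  finally show ?thesis .
qed auto

lemma real_local_triple_derivation_bounded:
  assumes E: "real_JB_star_triple scaleC tp E" and T: "local_triple_derivation scaleR tp E T"
  obtains K where "K \<ge> 0" "\<And>x. x \<in> E \<Longrightarrow> norm (T x) \<le> K * norm x"
proof -
  have E': "Real_Vector_Spaces.subspace E" "closed E" using E unfolding real_JB_star_triple_def by auto
  have TD: "\<And>x. x \<in> E \<Longrightarrow> T x \<in> E" "\<And>x y. x \<in> E \<Longrightarrow> y \<in> E \<Longrightarrow> T (x + y) = T x + T y"
    "\<And>r x. x \<in> E \<Longrightarrow> T (r *\<^sub>R x) = r *\<^sub>R T x"
    using T unfolding local_triple_derivation_def linear_self_map_on_def by blast+
  have "norm x \<le> norm (x - t *\<^sub>R T x)" if x: "x \<in> E" for x t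
  proof (cases "x = 0")
    case False
    show ?thesis
    proof (rule dissipative_norm_le)
      fix f assume f: "supports f ((1 / norm x) *\<^sub>R x)"
      have cf: "contractive_functional f" using f unfolding supports_def by auto
      have "(1 / norm x) *\<^sub>R x \<in> E" using x E'(1) by (simp add: real_vector.subspace_scale)
      from real_local_triple_derivation_dissipative[OF E T this f]
      show "Re (f (t *\<^sub>R T x)) = 0" using False by (simp add: TD(3)[OF x] contractiveD(4)[OF cf])
    qed
  qed auto
  then show thesis using dissipative_bounded[OF E' TD] that by blast
qed

lemma real_local_triple_derivation_continuous:
  assumes E: "real_JB_star_triple scaleC tp E" and T: "local_triple_derivation scaleR tp E T"
  shows "continuous_on E T"
proof -
  obtain K where K: "K \<ge> 0" "\<And>x. x \<in> E \<Longrightarrow> norm (T x) \<le> K * norm x"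
    by (rule real_local_triple_derivation_bounded[OF E T]) blast
  have E': "Real_Vector_Spaces.subspace E" using E unfolding real_JB_star_triple_def by auto
  have "T x - T y = T (x - y)" if "x \<in> E" "y \<in> E" for x y
  proof -
    have "T ((x - y) + y) = T (x - y) + T y"
      using T that real_vector.subspace_diff[OF E' that] unfolding local_triple_derivation_def linear_self_map_on_def
      by blast
    then show ?thesis by simp
  qed
  then have "K-lipschitz_on E T"
    using K E' by (intro lipschitz_onI) (auto simp: dist_norm real_vector.subspace_diff)
  then show ?thesis by (rule lipschitz_on_continuous_on)
qed

lemma local_triple_derivation_scaleR:
  assumes "local_triple_derivation scaleC tp UNIV T"
  shows "local_triple_derivation scaleR tp UNIV T"
proof -
  have lin: "linear_self_map_on scaleR UNIV S" if "linear_self_map_on scaleC UNIV S" for S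
    using that scaleC_of_real unfolding linear_self_map_on_def by metis
  show ?thesis
    using assms lin unfolding local_triple_derivation_def triple_derivation_def by blast
qed

lemma real_JB_star_triple_UNIV: "real_JB_star_triple scaleC tp UNIV"
  unfolding real_JB_star_triple_def using JB_star_triple_axioms by simp

end


section \<open>Quadratic maps with vanishing numerical range\<close>

context complex_banach_space
begin

text \<open>Complex differentiability of curves in \<open>'a\<close>, expressed through the real derivative because the
  complex scalar multiplication is not tied to a type class.\<close>

definition complex_derivative :: "(complex \<Rightarrow> 'a) \<Rightarrow> (complex \<Rightarrow> 'a) \<Rightarrow> bool" where
  "complex_derivative H H' \<longleftrightarrow> (\<forall>l. (H has_derivative (\<lambda>h. scaleC h (H' l))) (at l))"

lemma complex_derivative_add:
  "complex_derivative H H' \<Longrightarrow> complex_derivative J J' \<Longrightarrow>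
    complex_derivative (\<lambda>l. H l + J l) (\<lambda>l. H' l + J' l)"
  unfolding complex_derivative_def by (auto simp: scale_right_distrib intro!: has_derivative_add)

lemma complex_derivative_scaleR:
  "complex_derivative H H' \<Longrightarrow> complex_derivative (\<lambda>l. r *\<^sub>R H l) (\<lambda>l. r *\<^sub>R H' l)"
  unfolding complex_derivative_def by (auto simp: scaleC_scaleR intro!: has_derivative_scaleR_right)

lemma complex_derivative_contractive:
  assumes "complex_derivative H H'" "contractive_functional f"
  shows "((\<lambda>l. f (H l)) has_field_derivative f (H' l)) (at l)"
proof -
  have "((\<lambda>l. f (H l)) has_derivative (\<lambda>h. f (scaleC h (H' l)))) (at l)"
    using assms(1) unfolding complex_derivative_def
    by (intro bounded_linear.has_derivative[OF contractiveD(8)[OF assms(2)]]) blast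
  moreover have "(\<lambda>h. f (scaleC h (H' l))) = (*) (f (H' l))"
    by (rule ext) (simp add: contractiveD(2)[OF assms(2)])
  ultimately show ?thesis by (simp add: has_field_derivative_def)
qed

context
  fixes Q :: "'a \<Rightarrow> 'a \<Rightarrow> 'a" and K :: real
  assumes Q_add: "\<And>u v w. Q (u + v) w = Q u w + Q v w" "\<And>u v w. Q u (v + w) = Q u v + Q u w"
    and Q_scaleC: "\<And>c u v. Q (scaleC c u) v = scaleC c (Q u v)" "\<And>c u v. Q u (scaleC c v) = scaleC c (Q u v)"
    and Q_bound: "\<And>u v. norm (Q u v) \<le> K * norm u * norm v" and K: "K \<ge> 0"
begin

lemma Q_scaleR: "Q (r *\<^sub>R u) v = r *\<^sub>R Q u v" "Q u (r *\<^sub>R v) = r *\<^sub>R Q u v"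
  using Q_scaleC(1)[of "of_real r"] Q_scaleC(2)[of _ "of_real r"] by (auto simp: scaleC_of_real)

lemma bounded_bilinear_Q: "bounded_bilinear Q"
  by unfold_locales
     (auto simp: Q_add Q_scaleR intro!: exI[of _ K] order.trans[OF Q_bound] simp: mult_ac)

lemma complex_derivative_Q:
  assumes "complex_derivative H H'" "complex_derivative J J'"
  shows "complex_derivative (\<lambda>l. Q (H l) (J l)) (\<lambda>l. Q (H l) (J' l) + Q (H' l) (J l))"
proof -
  have "((\<lambda>l. Q (H l) (J l)) has_derivative
      (\<lambda>h. Q (H l) (scaleC h (J' l)) + Q (scaleC h (H' l)) (J l))) (at l)" for l
    by (rule bounded_bilinear.FDERIV[OF bounded_bilinear_Q])
       (use assms in \<open>auto simp: complex_derivative_def\<close>)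
  then show ?thesis
    unfolding complex_derivative_def Q_scaleC scale_right_distrib by blast
qed

definition quadratic_step :: "real \<Rightarrow> 'a \<Rightarrow> 'a" where
  "quadratic_step t z = z + t *\<^sub>R Q z z"

text \<open>Along the complex line through \<open>z\<close>, the \<open>n\<close>-fold iterate of \<open>z \<mapsto> z + t Q z z\<close> is an entire
  curve with second order coefficient \<open>n t Q z z\<close>: the quadratic terms of the factors add up.\<close>

lemma quadratic_step_iterate_derivatives:
  "\<exists>H H' H''. complex_derivative H H' \<and> complex_derivative H' H'' \<and> H 0 = 0 \<and> H' 0 = z
     \<and> H'' 0 = (2 * real n * t) *\<^sub>R Q z z \<and> (\<forall>l. H l = (quadratic_step t ^^ n) (scaleC l z))"
proof (induction n)
  case 0
  have "complex_derivative (\<lambda>l. scaleC l z) (\<lambda>_. z)"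
  proof -
    have "bounded_linear (\<lambda>l. scaleC l z)"
      by (rule bounded_linear_intro[of _ "norm z"])
         (auto simp: scale_left_distrib scaleR_scaleC scaleR_conv_of_real norm_scaleC)
    then show ?thesis unfolding complex_derivative_def
      by (auto intro: bounded_linear_imp_has_derivative)
  qed
  moreover have "complex_derivative (\<lambda>_. z) (\<lambda>_. 0)"
    unfolding complex_derivative_def by simp
  ultimately show ?case by (intro exI[of _ "\<lambda>l. scaleC l z"] exI[of _ "\<lambda>_. z"] exI[of _ "\<lambda>_. 0"]) auto
next
  case (Suc n)
  then obtain H H' H'' where IH: "complex_derivative H H'" "complex_derivative H' H''" "H 0 = 0" "H' 0 = z"
    "H'' 0 = (2 * real n * t) *\<^sub>R Q z z" "\<And>l. H l = (quadratic_step t ^^ n) (scaleC l z)" by blast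
  define J where "J l = H l + t *\<^sub>R Q (H l) (H l)" for l
  define J' where "J' l = H' l + t *\<^sub>R (Q (H l) (H' l) + Q (H' l) (H l))" for l
  define J'' where "J'' l = H'' l + t *\<^sub>R ((Q (H l) (H'' l) + Q (H' l) (H' l)) + (Q (H' l) (H' l) + Q (H'' l) (H l)))" for l
  have "complex_derivative J J'" unfolding J_def J'_def
    by (intro complex_derivative_add complex_derivative_scaleR complex_derivative_Q IH)
  moreover have "complex_derivative J' J''" unfolding J''_def J'_def
    by (intro complex_derivative_add complex_derivative_scaleR complex_derivative_Q IH)
  moreover have Q0: "Q 0 v = 0" "Q v 0 = 0" for v using Q_scaleR[of 0 0 v] Q_scaleR(2)[of v 0 0] by auto
  have "J 0 = 0" "J' 0 = z" by (auto simp: J_def J'_def IH(3,4) Q0)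
  moreover have "J'' 0 = (2 * real (Suc n) * t) *\<^sub>R Q z z"
    unfolding J''_def IH(3,4,5) Q0 by (simp add: algebra_simps flip: scaleR_2)
  moreover have "J l = (quadratic_step t ^^ Suc n) (scaleC l z)" for l
    by (simp add: J_def IH(6) quadratic_step_def)
  ultimately show ?case by blast
qed

text \<open>A single step increases norms only by \<open>O(t^2)\<close>: a functional attaining its norm at the new
  point \<open>w\<close> annihilates \<open>Q w w\<close>, which differs from \<open>Q z z\<close> by \<open>O(t)\<close>. So \<open>n\<close> steps of size
  \<open>t = s / n\<close> map the unit ball into the ball of radius two once \<open>n\<close> is large, and Cauchy's
  inequality for the second order coefficient yields \<open>s * norm (Q z z) \<le> 2\<close> for every \<open>s > 0\<close>.\<close>

lemma quadratic_zero:
  assumes zero: "\<And>f z. supports f z \<Longrightarrow> f (Q z z) = 0"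
  shows "Q z z = 0"
proof -
  \<comment> \<open>\<open>C * t\<close> bounds the norm of \<open>Q w w - Q u u\<close> for \<open>w = quadratic_step t u\<close> and \<open>norm u \<le> 2\<close>.\<close>
  define C where "C = 16 * K\<^sup>2 + 16 * K ^ 3"
  have C: "C \<ge> 0" using K by (simp add: C_def)
  have zero': "f (Q w w) = 0" if f: "contractive_functional f" "f w = of_real (norm w)" for f w
  proof (cases "w = 0")
    case True
    then show ?thesis using Q_scaleR(1)[of 0 0 0] contractiveD(5)[OF f(1)] by simp
  next
    case False
    have "supports f ((1 / norm w) *\<^sub>R w)"
      using f False by (simp add: supports_def contractiveD(4))
    from zero[OF this] show ?thesis
      using False by (simp add: Q_scaleR contractiveD(4)[OF f(1)])
  qed
  have step: "norm (quadratic_step t u) \<le> norm u + C * t\<^sup>2" if t: "0 \<le> t" "t \<le> 1" and u: "norm u \<le> 2" for t u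
  proof -
    define P where "P = Q u u"
    define w where "w = quadratic_step t u"
    have w: "w = u + t *\<^sub>R P" by (simp add: w_def P_def quadratic_step_def)
    obtain f where f: "contractive_functional f" "f w = of_real (norm w)"
      by (rule norm_attaining_functional)
    note fD = contractiveD[OF f(1)]
    have "norm P \<le> K * norm u * norm u" unfolding P_def by (rule Q_bound)
    also have "\<dots> \<le> K * 2 * 2" using K u by (intro mult_mono) auto
    finally have P: "norm P \<le> 4 * K" by simp
    define E where "E = Q u P + Q P u + t *\<^sub>R Q P P"
    have "Q w w = P + t *\<^sub>R E"
      unfolding w Q_add Q_scaleR E_def P_def[symmetric] by (simp add: scaleR_add_right add_ac)
    then have fP: "f P = - of_real t * f E" using zero'[OF f] by (simp add: fD add_eq_0_iff2)
    have "norm E \<le> norm (Q u P) + norm (Q P u) + t * norm (Q P P)"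
      unfolding E_def using norm_triangle_ineq[of "Q u P + Q P u" "t *\<^sub>R Q P P"]
        norm_triangle_ineq[of "Q u P" "Q P u"] t by simp
    also have "\<dots> \<le> K * 2 * (4 * K) + K * (4 * K) * 2 + 1 * (K * (4 * K) * (4 * K))"
      using t K u P by (intro add_mono mult_mono order.trans[OF Q_bound]) auto
    also have "\<dots> = C" by (simp add: C_def power2_eq_square power3_eq_cube)
    finally have "cmod (f E) \<le> C" using fD(3)[of E] by linarith
    then have "cmod (f P) \<le> t * C" using t unfolding fP norm_mult by (simp add: mult_left_mono)
    moreover have "norm w = Re (f u) + t * Re (f P)"
      using arg_cong[OF f(2), of Re] unfolding w fD(1) fD(4) by simp
    moreover have "Re (f u) \<le> norm u" using fD(3)[of u] complex_Re_le_cmod[of "f u"] by linarith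
    moreover have "t * Re (f P) \<le> t * (t * C)"
      using t complex_Re_le_cmod[of "f P"] \<open>cmod (f P) \<le> t * C\<close> by (intro mult_left_mono) auto
    ultimately show ?thesis unfolding w_def by (simp add: power2_eq_square mult_ac)
  qed
  have iterate: "norm ((quadratic_step t ^^ n) u) \<le> 1 + real n * C * t\<^sup>2"
    if t: "0 \<le> t" "t \<le> 1" and u: "norm u \<le> 1" and n: "real n * C * t\<^sup>2 \<le> 1" for t n u
    using n
  proof (induction n)
    case 0 then show ?case using u by simp
  next
    case (Suc n)
    have "0 \<le> C * t\<^sup>2" using C by simp
    then have n: "real n * C * t\<^sup>2 \<le> 1" using Suc.prems by (simp add: algebra_simps)
    then have "norm ((quadratic_step t ^^ n) u) \<le> 2" using Suc.IH by simp
    from step[OF t this] Suc.IH[OF n] show ?case by (simp add: algebra_simps)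
  qed
  have main: "real n * t * norm (Q u u) \<le> 2"
    if t: "0 \<le> t" "t \<le> 1" and u: "norm u \<le> 1" and n: "real n * C * t\<^sup>2 \<le> 1" for t n u
  proof -
    obtain H H' H'' where H: "complex_derivative H H'" "complex_derivative H' H''"
      "H'' 0 = (2 * real n * t) *\<^sub>R Q u u" "\<And>l. H l = (quadratic_step t ^^ n) (scaleC l u)"
      using quadratic_step_iterate_derivatives[of u n t] by blast
    obtain f where f: "contractive_functional f" "f (Q u u) = of_real (norm (Q u u))"
      by (rule norm_attaining_functional)
    note der = complex_derivative_contractive[OF _ f(1)]
    have "deriv (\<lambda>l. f (H l)) = (\<lambda>l. f (H' l))" "deriv (\<lambda>l. f (H' l)) = (\<lambda>l. f (H'' l))"
      using der[OF H(1)] der[OF H(2)] DERIV_imp_deriv by blast+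
    then have d2: "(deriv ^^ 2) (\<lambda>l. f (H l)) 0 = of_real (2 * real n * t * norm (Q u u))"
      by (simp add: numeral_2_eq_2 H(3) contractiveD(4)[OF f(1)] f(2))
    have hol: "(\<lambda>l. f (H l)) holomorphic_on A" for A
      unfolding holomorphic_on_def field_differentiable_def
      using der[OF H(1)] has_field_derivative_at_within by blast
    have "cmod ((deriv ^^ 2) (\<lambda>l. f (H l)) 0) \<le> fact 2 * 2 / 1 ^ 2"
    proof (rule Cauchy_inequality)
      show "continuous_on (cball 0 1) (\<lambda>l. f (H l))"
        by (rule holomorphic_on_imp_continuous_on[OF hol])
      show "cmod (f (H l)) \<le> 2" if "norm (0 - l) = 1" for l
      proof -
        have "norm (H l) \<le> 1 + real n * C * t\<^sup>2"
          unfolding H(4) using that u by (intro iterate t n) (auto simp: norm_scaleC)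
        then show ?thesis using n contractiveD(3)[OF f(1), of "H l"] by linarith
      qed
    qed (auto simp: hol)
    then show ?thesis using t unfolding d2 norm_of_real by (simp add: mult_ac)
  qed
  have unit: "Q u u = 0" if u: "norm u \<le> 1" for u
  proof (rule ccontr)
    assume "Q u u \<noteq> 0"
    \<comment> \<open>The total time \<open>s\<close> of the flow for which \<open>s * norm (Q u u)\<close> is \<open>3\<close>, beyond the bound \<open>2\<close>.\<close>
    define s where "s = 3 / norm (Q u u)"
    have s: "s > 0" using \<open>Q u u \<noteq> 0\<close> by (simp add: s_def)
    obtain m where m: "real m \<ge> max s (C * s\<^sup>2)" using real_arch_simple by blast
    then have m0: "real m > 0" using s by linarith
    have "real m * (s / real m) * norm (Q u u) \<le> 2"
    proof (rule main)
      show "real m * C * (s / real m)\<^sup>2 \<le> 1"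
        using m m0 by (simp add: power2_eq_square field_simps)
    qed (use s m m0 u in auto)
    then show False using m0 \<open>Q u u \<noteq> 0\<close> by (simp add: s_def)
  qed
  show ?thesis
  proof (cases "z = 0")
    case False
    have "Q ((1 / norm z) *\<^sub>R z) ((1 / norm z) *\<^sub>R z) = 0" by (rule unit) simp
    then show ?thesis using False by (simp add: Q_scaleR)
  qed (use unit[of 0] in simp)
qed

end

end

section \<open>Local derivations of complex triples\<close>

context JB_star_triple
begin

text \<open>Polarisation of the hermitian operators \<open>L(a,a)\<close>: the form \<open>(u, v) \<mapsto> f {u,v,z}\<close> has a real
  diagonal.\<close>

lemma supports_hermitian:
  assumes f: "supports f z" shows "f (tp v u z) = cnj (f (tp u v z))"
proof -
  have cf: "contractive_functional f" and z: "norm z = 1" "f z = 1" using f unfolding supports_def by auto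
  note fD = contractiveD[OF cf]
  have lin: "Vector_Spaces.linear scaleC (*) f"
  proof -
    have "vector_space ((*) :: complex \<Rightarrow> complex \<Rightarrow> complex)"
      by unfold_locales (auto simp: algebra_simps)
    then show ?thesis using vector_space_axioms by (simp add: Vector_Spaces.linear_iff fD)
  qed
  have "onorm f \<le> 1" by (rule onorm_bound) (auto simp: fD)
  moreover have "1 \<le> onorm f" using onorm[OF fD(8), of z] z by simp
  ultimately have on: "onorm f = 1" by simp
  have "f (tp a a z) \<in> \<real>" for a
  proof -
    have "f (tp a a z) \<in> numerical_range scaleC (\<lambda>x. tp a a x)"
      unfolding numerical_range_def using lin fD(8) on z by blast
    then show ?thesis using hermitian_L[of a] unfolding hermitian_operator_def by blast
  qed
  then have real: "Im (f (tp a a z)) = 0" for a by (simp add: complex_is_Real_iff)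
  have "Im (f (tp u v z)) + Im (f (tp v u z)) = 0"
    using real[of "u + v"] real[of u] real[of v] by (simp add: tp_add fD)
  moreover have "Re (f (tp v u z)) - Re (f (tp u v z)) = 0"
    using real[of "u + scaleC \<i> v"] real[of u] real[of v]
    by (simp add: tp_add tp_scaleC_left tp_scaleC_middle fD)
  ultimately show ?thesis by (simp add: complex_eq_iff)
qed

text \<open>Since \<open>f (plateau y) = (3 - f {y,y,y}) / 2\<close> has modulus at most one, \<open>f {y,y,y} = 1\<close>, so \<open>f\<close>
  also supports \<open>plateau y\<close>. The tangency relation for \<open>v\<close> and \<open>\<i> v\<close>, combined with
  \<open>f {y,v,y} = cnj (f {v,y,y})\<close>, gives both identities.\<close>

lemma supports_tp:
  assumes f: "supports f y"
  shows "f (tp v y y) = f v" "f (tp y v y) = cnj (f v)"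
proof -
  have cf: "contractive_functional f" and y: "norm y = 1" "f y = 1" using f unfolding supports_def by auto
  note fD = contractiveD[OF cf]
  have fp: "f (plateau y) = (3 - f (cube y)) / 2" by (simp add: plateau_def fD y)
  have np: "norm (plateau y) \<le> 1" by (rule norm_plateau_le) (simp add: y)
  have "cmod (f (cube y)) \<le> 1" using fD(3)[of "cube y"] by (simp add: norm_cube_eq y)
  moreover have "cmod (f (plateau y)) \<le> 1" using fD(3)[of "plateau y"] np by linarith
  then have "Re (f (plateau y)) \<le> 1" using complex_Re_le_cmod[of "f (plateau y)"] by linarith
  then have "Re (f (cube y)) \<ge> 1" unfolding fp by simp
  ultimately have re1: "Re (f (cube y)) = 1"
    using complex_Re_le_cmod[of "f (cube y)"] by linarith
  have "(Re (f (cube y)))\<^sup>2 + (Im (f (cube y)))\<^sup>2 \<le> 1"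
    using \<open>cmod (f (cube y)) \<le> 1\<close> by (simp add: power_le_one flip: cmod_power2)
  then have "f (cube y) = 1" using re1 by (simp add: complex_eq_iff)
  then have "f (plateau y) = 1" by (simp add: fp)
  moreover have "1 \<le> norm (plateau y)" using fD(3)[of "plateau y"] calculation by simp
  ultimately have sp: "supports f (plateau y)" using np cf by (simp add: supports_def)
  have re: "Re (f v) = Re (f (tp v y y))" for v
    using supports_plateau_tangent[OF _ sp, of v] y(1)
    by (simp add: fD supports_hermitian[OF f, of y v])
  have "Im (f v) = Im (f (tp v y y))" for v
    using re[of "scaleC \<i> v"] by (simp add: tp_scaleC_left fD)
  then show 1: "f (tp v y y) = f v" using re by (simp add: complex_eq_iff)
  show "f (tp y v y) = cnj (f v)" using supports_hermitian[OF f, of y v] 1 by simp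
qed

text \<open>For small \<open>t > 0\<close> let \<open>J = (1 - t G)^{-1}\<close>. By dissipativity \<open>J\<close> is a contraction, and it fixes
  \<open>z\<close> because \<open>G z = 0\<close>. So \<open>f\<close> composed with \<open>J\<close> supports \<open>z\<close> as well, and \<open>supports_tp\<close> applies
  to it. Comparing the terms of first order in \<open>t\<close> gives the claim; an exact contraction is
  essential here, since a perturbation of \<open>f\<close> with norm \<open>1 + O(t^2)\<close> would not determine them.\<close>

lemma skew_hermitian_annihilating:
  assumes G_add: "\<And>u v. G (u + v) = G u + G v" and G_scaleC: "\<And>c u. G (scaleC c u) = scaleC c (G u)"
    and G_bound: "\<And>u. norm (G u) \<le> K * norm u" and K: "K \<ge> 0"
    and skew: "\<And>f x. supports f x \<Longrightarrow> Re (f (G x)) = 0"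
    and Gz: "G z = 0" and f: "supports f z"
  shows "f (G (tp z a z)) = cnj (f (G a))"
proof -
  have cf: "contractive_functional f" and z: "norm z = 1" "f z = 1" using f unfolding supports_def by auto
  note fD = contractiveD[OF cf]
  have Gr: "G (r *\<^sub>R u) = r *\<^sub>R G u" for r u using G_scaleC[of "of_real r"] by (simp add: scaleC_of_real)
  have Gd: "G (u - v) = G u - G v" for u v using G_add[of "u - v" v] by simp
  have dis: "norm u \<le> norm (u - t *\<^sub>R G u)" for u t
  proof (cases "u = 0")
    case False
    show ?thesis
    proof (rule dissipative_norm_le)
      fix g assume g: "supports g ((1 / norm u) *\<^sub>R u)"
      then have "contractive_functional g" unfolding supports_def by auto
      then show "Re (g (t *\<^sub>R G u)) = 0"
        using skew[OF g] False by (simp add: Gr contractiveD(4))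
    qed
  qed auto
  define c where "c = tp z a z"
  have est: "cmod (f (G c) - cnj (f (G a))) \<le> K\<^sup>2 * (norm a + norm c) * t"
    if t: "0 < t" "t \<le> 1 / (2 * K + 2)" for t
  proof -
    have "t * (2 * K + 2) \<le> 1" using t K by (simp add: pos_le_divide_eq)
    then have tK: "t * K \<le> 1 / 2" using t by (simp add: algebra_simps)
    have "\<exists>u. u - t *\<^sub>R G u = b" for b
    proof -
      have "\<exists>!u. b + t *\<^sub>R G u = u"
      proof (rule banach_fix_type[of "t * K"], goal_cases)
        case 3
        show ?case
        proof (intro allI)
          fix u v
          have "norm (t *\<^sub>R G (u - v)) \<le> t * (K * norm (u - v))" using G_bound[of "u - v"] t by simp
          then show "dist (b + t *\<^sub>R G u) (b + t *\<^sub>R G v) \<le> t * K * dist u v"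
            by (simp add: dist_norm Gd scaleR_diff_right mult.assoc)
        qed
      qed (use t K tK in auto)
      then obtain u where "b + t *\<^sub>R G u = u" by blast
      then show ?thesis by (metis add_diff_cancel_right')
    qed
    then obtain J where J: "\<And>b. J b - t *\<^sub>R G (J b) = b" by metis
    have uniq: "u = v" if "u - t *\<^sub>R G u = v - t *\<^sub>R G v" for u v
    proof -
      have "norm (u - v) \<le> norm ((u - v) - t *\<^sub>R G (u - v))" by (rule dis)
      also have "(u - v) - t *\<^sub>R G (u - v) = (u - t *\<^sub>R G u) - (v - t *\<^sub>R G v)"
        by (simp add: Gd scaleR_diff_right)
      finally show ?thesis using that by simp
    qed
    \<comment> \<open>The identities for \<open>J\<close> hold because \<open>1 - t G\<close> is injective.\<close>
    have "supports (\<lambda>b. f (J b)) z"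
      unfolding supports_def contractive_functional_def
    proof (intro conjI allI)
      show "f (J (u + v)) = f (J u) + f (J v)" for u v
      proof -
        have "J (u + v) = J u + J v"
        proof (rule uniq)
          have "(J u + J v) - t *\<^sub>R G (J u + J v) = (J u - t *\<^sub>R G (J u)) + (J v - t *\<^sub>R G (J v))"
            by (simp add: G_add scaleR_add_right)
          then show "J (u + v) - t *\<^sub>R G (J (u + v)) = (J u + J v) - t *\<^sub>R G (J u + J v)"
            unfolding J by simp
        qed
        then show ?thesis by (simp add: fD)
      qed
      show "f (J (scaleC r u)) = r * f (J u)" for r u
      proof -
        have "J (scaleC r u) = scaleC r (J u)"
        proof (rule uniq)
          have "scaleC r (J u) - t *\<^sub>R G (scaleC r (J u)) = scaleC r (J u - t *\<^sub>R G (J u))"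
            by (simp add: G_scaleC scale_right_diff_distrib scaleC_scaleR)
          then show "J (scaleC r u) - t *\<^sub>R G (J (scaleC r u)) = scaleC r (J u) - t *\<^sub>R G (scaleC r (J u))"
            unfolding J by simp
        qed
        then show ?thesis by (simp add: fD)
      qed
      show "cmod (f (J u)) \<le> norm u" for u
        using fD(3)[of "J u"] dis[of "J u" t] unfolding J by linarith
      have "J z = z" by (rule uniq) (simp only: J, simp add: Gz)
      then show "f (J z) = 1" using z by simp
    qed (rule z)
    then have key: "f (J c) = cnj (f (J a))" unfolding c_def by (rule supports_tp)
    have expand: "J b = b + t *\<^sub>R G b + t\<^sup>2 *\<^sub>R G (G (J b))" for b
    proof -
      have "J b = b + t *\<^sub>R G (J b)" using J[of b] by (simp add: algebra_simps)
      then have "J b = b + t *\<^sub>R G (b + t *\<^sub>R G (J b))" by metis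
      then show ?thesis by (simp add: G_add Gr scaleR_add_right power2_eq_square add_ac)
    qed
    have rem: "cmod (f (G (G (J b)))) \<le> K\<^sup>2 * norm b" for b
    proof -
      have "norm (G (G (J b))) \<le> K * (K * norm (J b))"
        by (rule order.trans[OF G_bound mult_left_mono[OF G_bound K]])
      also have "norm (J b) \<le> norm b" using dis[of "J b" t] unfolding J .
      finally show ?thesis using fD(3)[of "G (G (J b))"] K
        by (simp add: power2_eq_square mult_left_mono mult.assoc order.trans)
    qed
    have fc: "f c = cnj (f a)" unfolding c_def by (rule supports_tp[OF f])
    have "of_real t * (f (G c) - cnj (f (G a))) =
        of_real (t\<^sup>2) * (cnj (f (G (G (J a)))) - f (G (G (J c))))"
    proof -
      have "f (c + t *\<^sub>R G c + t\<^sup>2 *\<^sub>R G (G (J c))) = cnj (f (a + t *\<^sub>R G a + t\<^sup>2 *\<^sub>R G (G (J a))))"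
        using key expand by metis
      then show ?thesis by (simp add: fD fc algebra_simps)
    qed
    then have "t * cmod (f (G c) - cnj (f (G a))) = t\<^sup>2 * cmod (cnj (f (G (G (J a)))) - f (G (G (J c))))"
      using t by (metis norm_mult norm_of_real abs_of_pos zero_less_power)
    also have "\<dots> \<le> t\<^sup>2 * (K\<^sup>2 * norm a + K\<^sup>2 * norm c)"
      using norm_triangle_ineq4[of "cnj (f (G (G (J a))))" "f (G (G (J c)))"] rem[of a] rem[of c]
      by (intro mult_left_mono) auto
    finally have "t * cmod (f (G c) - cnj (f (G a))) \<le> t * (K\<^sup>2 * (norm a + norm c) * t)"
      by (simp add: power2_eq_square algebra_simps)
    then show ?thesis using t by simp
  qed
  have "cmod (f (G c) - cnj (f (G a))) \<le> 0"
  proof (rule tendsto_lowerbound)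
    show "((\<lambda>t. K\<^sup>2 * (norm a + norm c) * t) \<longlongrightarrow> 0) (at_right 0)"
      by (rule tendsto_eq_intros refl | simp)+
    show "\<forall>\<^sub>F t in at_right 0. cmod (f (G c) - cnj (f (G a))) \<le> K\<^sup>2 * (norm a + norm c) * t"
      using est K by (auto simp: eventually_at_right_field intro!: exI[of _ "1 / (2 * K + 2)"])
  qed simp
  then show ?thesis by (simp add: c_def)
qed

text \<open>If \<open>\<delta>\<close> is a derivation with \<open>\<delta> z = T z\<close> and \<open>G = T - \<delta>\<close>, the defect \<open>Q a z z\<close> of the derivation
  rule equals \<open>G {z,a,z} - {z,G a,z}\<close>, on which every functional supporting \<open>z\<close> vanishes. So the
  quadratic map \<open>Q a\<close> is zero, and by polarisation so is the symmetric form.\<close>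

lemma local_triple_derivation_imp_triple_derivation:
  assumes T: "local_triple_derivation scaleC tp UNIV T"
  shows "triple_derivation scaleC tp UNIV T"
proof -
  have linD: "S (u + v) = S u + S v" "S (scaleC c u) = scaleC c (S u)"
    if "local_triple_derivation scaleC tp UNIV S" for S u v c
    using that unfolding local_triple_derivation_def linear_self_map_on_def by blast+
  have skew: "Re (f (S x)) = 0" if "local_triple_derivation scaleC tp UNIV S" "supports f x" for S f x
    using real_local_triple_derivation_dissipative[OF real_JB_star_triple_UNIV
        local_triple_derivation_scaleR[OF that(1)] UNIV_I that(2)] .
  have bounded: "\<exists>K\<ge>0. \<forall>x. norm (S x) \<le> K * norm x" if "local_triple_derivation scaleC tp UNIV S" for S
    using real_local_triple_derivation_bounded[OF real_JB_star_triple_UNIV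
        local_triple_derivation_scaleR[OF that]] by (metis UNIV_I)
  obtain KT where KT: "KT \<ge> 0" "\<And>x. norm (T x) \<le> KT * norm x" using bounded[OF T] by blast
  obtain M where M: "M > 0" "\<And>x y z. norm (tp x y z) \<le> M * norm x * norm y * norm z"
    by (rule tp_bounded) blast
  define Q where "Q a z w = T (tp z a w) - tp (T z) a w - tp z (T a) w - tp z a (T w)" for a z w
  have "f (Q a z z) = 0" if f: "supports f z" for f a z
  proof -
    obtain \<delta> where \<delta>: "triple_derivation scaleC tp UNIV \<delta>" "T z = \<delta> z"
      using T unfolding local_triple_derivation_def by blast
    then have \<delta>l: "local_triple_derivation scaleC tp UNIV \<delta>"
      unfolding local_triple_derivation_def triple_derivation_def by blast
    have der: "\<delta> (tp x y w) = tp (\<delta> x) y w + tp x (\<delta> y) w + tp x y (\<delta> w)" for x y w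
      using \<delta>(1) unfolding triple_derivation_def by blast
    obtain K\<delta> where K\<delta>: "K\<delta> \<ge> 0" "\<And>x. norm (\<delta> x) \<le> K\<delta> * norm x" using bounded[OF \<delta>l] by blast
    define G where "G u = T u - \<delta> u" for u
    have cf: "contractive_functional f" using f unfolding supports_def by auto
    have "f (G (tp z a z)) = cnj (f (G a))"
    proof (rule skew_hermitian_annihilating[of G "KT + K\<delta>"])
      show "norm (G u) \<le> (KT + K\<delta>) * norm u" for u
        unfolding G_def using norm_triangle_ineq4[of "T u" "\<delta> u"] KT(2)[of u] K\<delta>(2)[of u]
        by (simp add: algebra_simps)
      show "Re (g (G x)) = 0" if "supports g x" for g x
        using skew[OF T that] skew[OF \<delta>l that] that
        by (simp add: G_def contractiveD(7) supports_def)
    qed (use KT K\<delta> \<delta>(2) f in \<open>auto simp: G_def linD[OF T] linD[OF \<delta>l] scale_right_diff_distrib\<close>)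
    moreover have "f (tp z (G a) z) = cnj (f (G a))" by (rule supports_tp[OF f])
    moreover have "Q a z z = G (tp z a z) - tp z (G a) z"
      unfolding Q_def G_def der \<delta>(2) tp_diff by (simp add: algebra_simps)
    ultimately show ?thesis by (simp add: contractiveD[OF cf])
  qed
  have "Q a z z = 0" for a z
  proof (rule quadratic_zero[of "Q a" "4 * (M * KT * norm a)"])
    show "norm (Q a u v) \<le> 4 * (M * KT * norm a) * norm u * norm v" for u v
    proof -
      have "norm (T (tp u a v)) \<le> KT * (M * norm u * norm a * norm v)"
        by (rule order.trans[OF KT(2) mult_left_mono[OF M(2) KT(1)]])
      moreover have "norm (tp (T u) a v) \<le> M * (KT * norm u) * norm a * norm v"
        using M(1) KT by (intro order.trans[OF M(2)] mult_right_mono mult_left_mono) auto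
      moreover have "norm (tp u (T a) v) \<le> M * norm u * (KT * norm a) * norm v"
        using M(1) KT by (intro order.trans[OF M(2)] mult_right_mono mult_left_mono) auto
      moreover have "norm (tp u a (T v)) \<le> M * norm u * norm a * (KT * norm v)"
        using M(1) KT by (intro order.trans[OF M(2)] mult_right_mono mult_left_mono) auto
      moreover have "norm (Q a u v) \<le> norm (T (tp u a v)) + norm (tp (T u) a v) + norm (tp u (T a) v) + norm (tp u a (T v))"
        unfolding Q_def by (meson add_right_mono norm_triangle_ineq4 order.trans)
      ultimately show ?thesis by (simp add: mult_ac)
    qed
  qed (use M(1) KT(1) \<open>\<And>f a z. supports f z \<Longrightarrow> f (Q a z z) = 0\<close> in
      \<open>auto simp: Q_def linD[OF T] tp_add tp_scaleC_left tp_scaleC_right scale_right_diff_distrib algebra_simps\<close>)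
  have sym: "Q a z w = Q a w z" for a z w
    unfolding Q_def by (simp add: tp_symmetric[of z] tp_symmetric[of "T z"] algebra_simps)
  have "Q a z w = 0" for a z w
  proof -
    have "Q a (z + w) (z + w) = Q a z z + Q a z w + (Q a w z + Q a w w)"
      unfolding Q_def by (simp add: linD[OF T] tp_add algebra_simps)
    then have "Q a z w + Q a z w = 0"
      using \<open>\<And>a z. Q a z z = 0\<close> sym[of a z w] by simp
    then show ?thesis by (simp flip: scaleR_2)
  qed
  then have "T (tp z a w) = tp (T z) a w + tp z (T a) w + tp z a (T w)" for z a w
    unfolding Q_def by (simp add: algebra_simps)
  moreover have "linear_self_map_on scaleC UNIV T"
    using T unfolding local_triple_derivation_def by blast
  ultimately show ?thesis unfolding triple_derivation_def by blast
qed

end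

theorem theorem2p8:
  fixes scaleC :: "complex \<Rightarrow> 'a::banach \<Rightarrow> 'a"
    and tp :: "'a \<Rightarrow> 'a \<Rightarrow> 'a \<Rightarrow> 'a"
  assumes "JB_star_triple scaleC tp"
  shows "(\<forall>E T. real_JB_star_triple scaleC tp E \<and> local_triple_derivation scaleR tp E T
              \<longrightarrow> continuous_on E T)
       \<and> (\<forall>T. local_triple_derivation scaleC tp UNIV T \<longrightarrow> continuous_on UNIV T)
       \<and> (\<forall>T. local_triple_derivation scaleC tp UNIV T \<longrightarrow> triple_derivation scaleC tp UNIV T)"
proof -
  interpret JB_star_triple scaleC tp by (rule assms)
  show ?thesis
    using real_local_triple_derivation_continuous real_JB_star_triple_UNIV
      local_triple_derivation_scaleR local_triple_derivation_imp_triple_derivation by blast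
qed

end
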